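(* (Implicit diffusion limit of the modified UGKS.) When $\varepsilon$ tends to $0$, the modified UGKS, in which the slopes are defined by $$\delta_x\rho^{nL}_{i+1/2}=\frac{\rho^n_{i+1/2}-\rho^{n+1}_i}{\Delta x/2},\qquad \delta_x\rho^{nR}_{i+1/2}=\frac{\rho^{n+1}_{i+1}-\rho^n_{i+1/2}}{\Delta x/2},$$ all the other quantities of the scheme being unchanged, converges to the following implicit discrete diffusion equation: $$\frac{\rho_i^{n+1}-\rho_i^n}{\Delta t}-\frac{1}{\Delta x}\biggl(\frac{1}{3\sigma_{i+1/2}}\frac{\rho_{i+1}^{n+1}-\rho_i^{n+1}}{\Delta x}-\frac{1}{3\sigma_{i-1/2}}\frac{\rho_i^{n+1}-\rho_{i-1}^{n+1}}{\Delta x}\biggr)=-\alpha_i\rho_i^{n+1}+G .$$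
   Context: The average of a function $\phi$ of $v\in[-1,1]$ is $\langle\phi\rangle=\frac12\int_{-1}^1\phi(v)\,dv$; $\mathbf 1_{v>0},\mathbf 1_{v<0}$ are indicator functions. The unified gas kinetic scheme (UGKS) approximates the linear kinetic equation $\varepsilon\partial_tf+v\partial_xf=\frac{\sigma}{\varepsilon}(\langle f\rangle-f)-\varepsilon\alpha f+\varepsilon G$, where $\sigma,\alpha,G$ may depend on $x$ but not on $v$. The grid has space step $\Delta x$, cells $i$ with interfaces $x_{i\pm1/2}$, and time step $\Delta t$; $\sigma_i,\alpha_i$ and $\sigma_{i+1/2},\alpha_{i+1/2}$ are the values of $\sigma,\alpha$ in cell $i$ and at the interface $x_{i+1/2}$. With $f_i^n(v)$ the approximation of the average of $f(t_n,\cdot,v)$ over cell $i$ and $\rho_i^n=\langle f_i^n\rangle$, the scheme computes $\rho_i^{n+1}$ by $$\frac{\rho_i^{n+1}-\rho_i^n}{\Delta t}+\frac{1}{\Delta x}(\Phi_{i+1/2}-\Phi_{i-1/2})=-\alpha_i\rho_i^{n+1}+G,\qquad \Phi_{i+1/2}=\langle\phi_{i+1/2}\rangle,$$ and then $f_i^{n+1}$ by $$\frac{f_i^{n+1}-f_i^n}{\Delta t}+\frac{1}{\Delta x}(\phi_{i+1/2}-\phi_{i-1/2})=\frac{\sigma_i}{\varepsilon^2}(\rho_i^{n+1}-f_i^{n+1})-\alpha_if_i^{n+1}+G,$$ with the microscopic flux $$\phi_{i+1/2}=A_{i+1/2}v(f_i^n\mathbf 1_{v>0}+f_{i+1}^n\mathbf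 1_{v<0})+C_{i+1/2}v\rho^n_{i+1/2}+D_{i+1/2}v^2(\delta_x\rho^{nL}_{i+1/2}\mathbf 1_{v>0}+\delta_x\rho^{nR}_{i+1/2}\mathbf 1_{v<0})+E_{i+1/2}vG,$$ where $\rho^n_{i+1/2}=\langle f_i^n\mathbf 1_{v>0}+f_{i+1}^n\mathbf 1_{v<0}\rangle$ is taken at time $t_n$. In the original scheme the slopes use $\rho_i^n$ and $\rho_{i+1}^n$ in place of $\rho_i^{n+1}$ and $\rho_{i+1}^{n+1}$. In the modified scheme, the relation for $\rho^{n+1}$ is implicit (a tridiagonal linear system), while the relation for $f^{n+1}$ is still explicit with respect to $f$ in the transport part. Here $A_{i+1/2}=A(\Delta t,\varepsilon,\sigma_{i+1/2},\alpha_{i+1/2})$, likewise for $C,D,E$, and, with $\nu=\frac{\sigma}{\varepsilon^2}+\alpha$, $A=\frac{1}{\Delta t\varepsilon\nu}(1-e^{-\nu\Delta t})$, $C=\frac{\sigma}{\Delta t\varepsilon^3\nu}\bigl(\Delta t-\frac1\nu(1-e^{-\nu\Delta t})\bigr)$, $D=-\frac{\sigma}{\Delta t\varepsilon^4\nu^2}\bigl(\Delta t(1+e^{-\nu\Delta t})-\frac2\nu(1-e^{-\nu\Delta t})\bigr)$, $E=\frac{1}{\Delta t\varepsilon\nu}\bigl(\Delta t-\frac1\nu(1-e^{-\nu\Delta t})\bigr)$. *)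

theory Defs
  imports "HOL-Analysis.Analysis"
begin

(* Cells are indexed by int. A face quantity at index i lives at the interface
   x_{i+1/2} between cells i and i+1; index i - 1 therefore gives x_{i-1/2}. *)

record ugks_data =
  dx :: real
  dt :: real
  sigma_cell :: "int \<Rightarrow> real"
  sigma_face :: "int \<Rightarrow> real"
  alpha_cell :: "int \<Rightarrow> real"
  alpha_face :: "int \<Rightarrow> real"
  G_cell :: "int \<Rightarrow> real"
  G_face :: "int \<Rightarrow> real"

definition mean :: "(real \<Rightarrow> real) \<Rightarrow> real" where
  "mean g = 1 / 2 * (LBINT v:{-1..1}. g v)"

definition nu :: "real \<Rightarrow> real \<Rightarrow> real \<Rightarrow> real" where
  "nu eps s a = s / eps ^ 2 + a"

definition coefA :: "real \<Rightarrow> real \<Rightarrow> real \<Rightarrow> real \<Rightarrow> real" where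
  "coefA h eps s a =
     1 / (h * eps * nu eps s a) * (1 - exp (- nu eps s a * h))"

definition coefC :: "real \<Rightarrow> real \<Rightarrow> real \<Rightarrow> real \<Rightarrow> real" where
  "coefC h eps s a =
     s / (h * eps ^ 3 * nu eps s a) *
       (h - 1 / nu eps s a * (1 - exp (- nu eps s a * h)))"

definition coefD :: "real \<Rightarrow> real \<Rightarrow> real \<Rightarrow> real \<Rightarrow> real" where
  "coefD h eps s a =
     - (s / (h * eps ^ 4 * nu eps s a ^ 2)) *
       (h * (1 + exp (- nu eps s a * h))
        - 2 / nu eps s a * (1 - exp (- nu eps s a * h)))"

definition coefE :: "real \<Rightarrow> real \<Rightarrow> real \<Rightarrow> real \<Rightarrow> real" where
  "coefE h eps s a =
     1 / (h * eps * nu eps s a) *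
       (h - 1 / nu eps s a * (1 - exp (- nu eps s a * h)))"

definition upwind :: "(real \<Rightarrow> real) \<Rightarrow> (real \<Rightarrow> real) \<Rightarrow> real \<Rightarrow> real" where
  "upwind gL gR v = gL v * indicator {0<..} v + gR v * indicator {..<0} v"

(* The arguments rho and f are indexed by time level first: rho n i and f n i v. *)

definition rho_face :: "(nat \<Rightarrow> int \<Rightarrow> real \<Rightarrow> real) \<Rightarrow> nat \<Rightarrow> int \<Rightarrow> real" where
  "rho_face f n i = mean (upwind (f n i) (f n (i + 1)))"

(* Slopes of the modified scheme: the cell densities are taken at level n + 1,
   the face density at level n. *)

definition slopeL ::
  "ugks_data \<Rightarrow> (nat \<Rightarrow> int \<Rightarrow> real) \<Rightarrow> (nat \<Rightarrow> int \<Rightarrow> real \<Rightarrow> real) \<Rightarrow> nat \<Rightarrow> int \<Rightarrow> real"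
where
  "slopeL P rho f n i = (rho_face f n i - rho (n + 1) i) / (dx P / 2)"

definition slopeR ::
  "ugks_data \<Rightarrow> (nat \<Rightarrow> int \<Rightarrow> real) \<Rightarrow> (nat \<Rightarrow> int \<Rightarrow> real \<Rightarrow> real) \<Rightarrow> nat \<Rightarrow> int \<Rightarrow> real"
where
  "slopeR P rho f n i = (rho (n + 1) (i + 1) - rho_face f n i) / (dx P / 2)"

definition micro_flux ::
  "ugks_data \<Rightarrow> real \<Rightarrow> (nat \<Rightarrow> int \<Rightarrow> real) \<Rightarrow> (nat \<Rightarrow> int \<Rightarrow> real \<Rightarrow> real)
     \<Rightarrow> nat \<Rightarrow> int \<Rightarrow> real \<Rightarrow> real"
where
  "micro_flux P eps rho f n i v =
     coefA (dt P) eps (sigma_face P i) (alpha_face P i) * v * upwind (f n i) (f n (i + 1)) v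
   + coefC (dt P) eps (sigma_face P i) (alpha_face P i) * v * rho_face f n i
   + coefD (dt P) eps (sigma_face P i) (alpha_face P i) * v ^ 2 *
       (slopeL P rho f n i * indicator {0<..} v + slopeR P rho f n i * indicator {..<0} v)
   + coefE (dt P) eps (sigma_face P i) (alpha_face P i) * v * G_face P i"

definition macro_flux ::
  "ugks_data \<Rightarrow> real \<Rightarrow> (nat \<Rightarrow> int \<Rightarrow> real) \<Rightarrow> (nat \<Rightarrow> int \<Rightarrow> real \<Rightarrow> real)
     \<Rightarrow> nat \<Rightarrow> int \<Rightarrow> real"
where
  "macro_flux P eps rho f n i = mean (micro_flux P eps rho f n i)"

definition modified_ugks_step ::
  "ugks_data \<Rightarrow> real \<Rightarrow> (nat \<Rightarrow> int \<Rightarrow> real) \<Rightarrow> (nat \<Rightarrow> int \<Rightarrow> real \<Rightarrow> real)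
     \<Rightarrow> nat \<Rightarrow> int \<Rightarrow> bool"
where
  "modified_ugks_step P eps rho f n i \<longleftrightarrow>
     rho n i = mean (f n i) \<and>
     (rho (n + 1) i - rho n i) / dt P
       + 1 / dx P * (macro_flux P eps rho f n i - macro_flux P eps rho f n (i - 1))
       = - alpha_cell P i * rho (n + 1) i + G_cell P i \<and>
     (\<forall>v\<in>{-1..1}.
        (f (n + 1) i v - f n i v) / dt P
          + 1 / dx P * (micro_flux P eps rho f n i v - micro_flux P eps rho f n (i - 1) v)
          = sigma_cell P i / eps ^ 2 * (rho (n + 1) i - f (n + 1) i v)
            - alpha_cell P i * f (n + 1) i v + G_cell P i)"

definition implicit_diffusion_step ::
  "ugks_data \<Rightarrow> (nat \<Rightarrow> int \<Rightarrow> real) \<Rightarrow> nat \<Rightarrow> int \<Rightarrow> bool"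
where
  "implicit_diffusion_step P r n i \<longleftrightarrow>
     (r (n + 1) i - r n i) / dt P
       - 1 / dx P *
          (1 / (3 * sigma_face P i) * ((r (n + 1) (i + 1) - r (n + 1) i) / dx P)
           - 1 / (3 * sigma_face P (i - 1)) * ((r (n + 1) i - r (n + 1) (i - 1)) / dx P))
       = - alpha_cell P i * r (n + 1) i + G_cell P i"

definition kinetic_bound :: "real \<Rightarrow> (real \<Rightarrow> real) \<Rightarrow> bool" where
  "kinetic_bound M g \<longleftrightarrow>
     set_borel_measurable lborel {-1..1} g \<and> (\<forall>v\<in>{-1..1}. \<bar>g v\<bar> \<le> M)"

(* Solutions on the whole grid. An infinite tridiagonal system has spurious
   solutions that grow at infinity, so each time level is required to be bounded;
   the bound may depend on the level and on eps. *)

definition modified_ugks_solution ::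
  "ugks_data \<Rightarrow> real \<Rightarrow> (int \<Rightarrow> real \<Rightarrow> real) \<Rightarrow> (nat \<Rightarrow> int \<Rightarrow> real)
     \<Rightarrow> (nat \<Rightarrow> int \<Rightarrow> real \<Rightarrow> real) \<Rightarrow> bool"
where
  "modified_ugks_solution P eps f0 rho f \<longleftrightarrow>
     (\<forall>i. \<forall>v\<in>{-1..1}. f 0 i v = f0 i v) \<and>
     (\<forall>n. \<exists>M. \<forall>i. kinetic_bound M (f n i)) \<and>
     (\<forall>n i. modified_ugks_step P eps rho f n i)"

definition implicit_diffusion_solution ::
  "ugks_data \<Rightarrow> (int \<Rightarrow> real) \<Rightarrow> (nat \<Rightarrow> int \<Rightarrow> real) \<Rightarrow> bool"
where
  "implicit_diffusion_solution P r0 r \<longleftrightarrow>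
     r 0 = r0 \<and>
     (\<forall>n. bounded (range (r n))) \<and>
     (\<forall>n i. implicit_diffusion_step P r n i)"

(* Automatic on a periodic grid, given sigma > 0, apart from the last condition.
   That one makes the implicit systems uniquely solvable; it holds with c = 1 when
   alpha is an absorption coefficient (alpha >= 0). *)

definition uniform_data :: "ugks_data \<Rightarrow> bool" where
  "uniform_data P \<longleftrightarrow>
     (\<exists>s>0. \<forall>i. s \<le> sigma_cell P i \<and> s \<le> sigma_face P i) \<and>
     bounded (range (alpha_cell P)) \<and> bounded (range (alpha_face P)) \<and>
     bounded (range (G_cell P)) \<and> bounded (range (G_face P)) \<and>
     (\<exists>c>0. \<forall>i. c \<le> 1 + dt P * alpha_cell P i)"

end

theory Submission
  imports Defs
begin

text \<open>
  Averaging the kinetic flux over the velocity removes the multiples of \<open>v\<close>, in particular the term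
  with \<open>C\<close>, which blows up like \<open>1/\<epsilon>\<close>. The two slopes enter with the same weight
  \<open>\<langle>v\<^sup>2 1\<^bsub>v>0\<^esub>\<rangle> = \<langle>v\<^sup>2 1\<^bsub>v<0\<^esub>\<rangle> = 1/6\<close>, so the interface density at the old time cancels and the macroscopic
  flux is \<open>A\<langle>v f\<rangle> + D/(3 \<Delta>x) (\<rho>\<^bsub>i+1\<^esub> - \<rho>\<^bsub>i\<^esub>)\<close> with densities at the new time (\<open>macro_flux_eq\<close>).
  Since \<open>A \<rightarrow> 0\<close> and \<open>D \<rightarrow> - 1/\<sigma>\<close> (\<open>coef_bounds\<close>), the limit is the implicit diffusion scheme as
  soon as the distributions stay bounded; this is the local statement \<open>modified_ugks_step_limit\<close>.

  For the global statement both schemes are written as \<open>elliptic b k u = w\<close> on bounded sequences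
  indexed by the cells, an operator which is diagonally dominant with a gap \<open>c > 0\<close>. A maximum principle
  (\<open>elliptic_max_principle\<close>) gives uniqueness and the estimate \<open>c \<parallel>u\<parallel> \<le> \<parallel>w\<parallel>\<close>, and a contracting
  iteration gives existence (\<open>elliptic_solvable\<close>). Comparing the two equations yields an error
  of order \<open>\<epsilon>\<close> per time step (\<open>step_error\<close>). This uses an \<open>\<epsilon>\<close>-independent bound for the distributions, which
  is propagated from one level to the next: although the microscopic flux is of order \<open>1/\<epsilon>\<close>, the implicit
  relaxation divides it by \<open>\<sigma>/\<epsilon>\<^sup>2\<close> (\<open>kinetic_update_bound\<close>). An induction over the time levels
  (\<open>convergence\<close>) concludes.
\<close>

section \<open>Averages over the velocity interval\<close>

text \<open>
  The predicate \<^const>\<open>kinetic_bound\<close> is the only regularity available for distributions, and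
  all averages are computed from it; boundedness supplies integrability on \<open>[-1, 1]\<close>, so it is
  enough to know that the predicate is stable under the operations occurring in the flux.
\<close>

lemma kinetic_bound_integrable:
  assumes "kinetic_bound M g"
  shows "set_integrable lborel {-1..1} g"
  unfolding set_integrable_def
  using assms
  by (intro integrableI_bounded_set[where A="{-1..1}" and B=M] AE_I2)
     (auto simp: kinetic_bound_def set_borel_measurable_def)

lemma kinetic_bound_add:
  assumes "kinetic_bound M g" "kinetic_bound N k"
  shows "kinetic_bound (M + N) (\<lambda>v. g v + k v)"
proof -
  have "set_borel_measurable lborel {-1..1} (\<lambda>v. g v + k v)"
    using assms borel_measurable_add[of "\<lambda>v. indicator {-1..1} v *\<^sub>R g v" lborel "\<lambda>v. indicator {-1..1} v *\<^sub>R k v"]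
    by (simp add: kinetic_bound_def set_borel_measurable_def algebra_simps)
  moreover have "\<bar>g v + k v\<bar> \<le> M + N" if "v \<in> {-1..1}" for v
    using assms that abs_triangle_ineq[of "g v" "k v"] unfolding kinetic_bound_def by fastforce
  ultimately show ?thesis by (simp add: kinetic_bound_def)
qed

lemma kinetic_bound_mult:
  assumes "kinetic_bound M g" "kinetic_bound N k"
  shows "kinetic_bound (M * N) (\<lambda>v. k v * g v)"
proof -
  have "(\<lambda>v. (indicator {-1..1} v *\<^sub>R k v) * (indicator {-1..1} v *\<^sub>R g v)) \<in> borel_measurable lborel"
    using assms by (intro borel_measurable_times) (auto simp: kinetic_bound_def set_borel_measurable_def)
  also have "(\<lambda>v. (indicator {-1..1} v *\<^sub>R k v) * (indicator {-1..1} v *\<^sub>R g v))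
      = (\<lambda>v. indicator {-1..1} v *\<^sub>R (k v * g v))"
    by (auto split: split_indicator)
  finally have "set_borel_measurable lborel {-1..1} (\<lambda>v. k v * g v)"
    by (simp add: set_borel_measurable_def)
  moreover have "\<bar>k v * g v\<bar> \<le> M * N" if "v \<in> {-1..1}" for v
  proof -
    have "\<bar>g v\<bar> \<le> M" "\<bar>k v\<bar> \<le> N" using assms that unfolding kinetic_bound_def by auto
    moreover have "\<bar>k v\<bar> * \<bar>g v\<bar> \<le> N * M"
      using calculation by (intro mult_mono) linarith+
    ultimately show ?thesis by (simp add: abs_mult mult.commute)
  qed
  ultimately show ?thesis by (simp add: kinetic_bound_def)
qed

lemma kinetic_bound_borel:
  assumes "g \<in> borel_measurable borel" "\<And>v. v \<in> {-1..1} \<Longrightarrow> \<bar>g v\<bar> \<le> M"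
  shows "kinetic_bound M g"
  using assms unfolding kinetic_bound_def set_borel_measurable_def by auto

lemma kinetic_bound_scale:
  assumes "kinetic_bound M g"
  shows "kinetic_bound (\<bar>c\<bar> * M) (\<lambda>v. c * g v)"
  using kinetic_bound_mult[OF assms kinetic_bound_borel[of "\<lambda>v. c" "\<bar>c\<bar>"]] by (simp add: mult.commute)

lemma kinetic_bound_upwind:
  assumes "kinetic_bound M g" "kinetic_bound M k"
  shows "kinetic_bound M (upwind g k)"
proof -
  have "(\<lambda>v. (indicator {-1..1} v *\<^sub>R g v) * indicator {0<..} v
      + (indicator {-1..1} v *\<^sub>R k v) * indicator {..<0} v) \<in> borel_measurable lborel"
    using assms by (auto simp: kinetic_bound_def set_borel_measurable_def)
  also have "(\<lambda>v. (indicator {-1..1} v *\<^sub>R g v) * indicator {0<..} v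
      + (indicator {-1..1} v *\<^sub>R k v) * indicator {..<0} v)
      = (\<lambda>v. indicator {-1..1} v *\<^sub>R upwind g k v)"
    by (auto simp: upwind_def split: split_indicator)
  finally have "set_borel_measurable lborel {-1..1} (upwind g k)"
    by (simp add: set_borel_measurable_def)
  moreover have "0 \<le> M" using assms(1) unfolding kinetic_bound_def
    by (auto dest!: bspec[of _ _ 0])
  ultimately show ?thesis
    using assms by (auto simp: kinetic_bound_def upwind_def split: split_indicator)
qed

lemma kinetic_bound_nonneg: "kinetic_bound M g \<Longrightarrow> 0 \<le> M"
  unfolding kinetic_bound_def by (auto dest!: bspec[of _ _ 0])

lemma kinetic_bound_mono: "kinetic_bound M g \<Longrightarrow> M \<le> N \<Longrightarrow> kinetic_bound N g"
  unfolding kinetic_bound_def by force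

lemma kinetic_bound_cong:
  assumes "kinetic_bound M g" "\<And>v. v \<in> {-1..1} \<Longrightarrow> k v = g v"
  shows "kinetic_bound M k"
proof -
  have "(\<lambda>v. indicator {-1..1} v *\<^sub>R k v) = (\<lambda>v. indicator {-1..1} v *\<^sub>R g v)"
    using assms(2) by (auto split: split_indicator)
  then show ?thesis using assms by (simp add: kinetic_bound_def set_borel_measurable_def)
qed

lemma kinetic_bound_const: "kinetic_bound \<bar>c\<bar> (\<lambda>_. c)"
  by (rule kinetic_bound_borel) auto

lemma kinetic_bound_velocity: "kinetic_bound M g \<Longrightarrow> kinetic_bound M (\<lambda>v. v * g v)"
  using kinetic_bound_mult[OF _ kinetic_bound_borel[of "\<lambda>v. v" 1], of M g] by (simp add: abs_le_iff)

lemma mean_add: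
  assumes "kinetic_bound M g" "kinetic_bound N k"
  shows "mean (\<lambda>v. g v + k v) = mean g + mean k"
  using set_integral_add(2)[OF assms[THEN kinetic_bound_integrable]]
  by (simp add: mean_def algebra_simps)

lemma mean_scale: "mean (\<lambda>v. c * g v) = c * mean g"
  by (simp add: mean_def)

lemma mean_bound:
  assumes "kinetic_bound M g"
  shows "\<bar>mean g\<bar> \<le> M"
proof -
  have M: "set_integrable lborel {-1..1} (\<lambda>v::real. M)"
    unfolding set_integrable_def by (simp add: emeasure_lborel_Icc)
  have g: "set_integrable lborel {-1..1} g" using assms by (rule kinetic_bound_integrable)
  have "\<bar>LBINT v:{-1..1}. g v\<bar> \<le> (LBINT v:{-1..1}. \<bar>g v\<bar>)"
    using set_integral_norm_bound[OF g] by simp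
  also have "\<dots> \<le> (LBINT v::real:{-1..1}. M)"
    by (rule set_integral_mono) (use assms M set_integrable_norm[OF g] in \<open>auto simp: kinetic_bound_def\<close>)
  also have "\<dots> = 2 * M" by (simp add: set_lebesgue_integral_def)
  finally show ?thesis by (simp add: mean_def)
qed

lemma mean_const: "mean (\<lambda>_. c) = c"
  by (simp add: mean_def set_lebesgue_integral_def)

lemma mean_cong: "(\<And>v. v \<in> {-1..1} \<Longrightarrow> g v = k v) \<Longrightarrow> mean g = mean k"
  unfolding mean_def by (subst set_lebesgue_integral_cong[of _ _ g k]) auto

lemma mean_velocity: "mean (\<lambda>v. v) = 0"
  using integral_power[of "-1" 1 1]
  by (simp add: mean_def set_lebesgue_integral_def mult.commute)

text \<open>
  These two half moments are the source of the factor \<open>1/3\<close> in the diffusion coefficient: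
  the left and right slopes share the same weight, so the time-\<open>n\<close> interface density cancels
  from their sum.
\<close>

lemma mean_half_square:
  "mean (\<lambda>v. v\<^sup>2 * indicator {0<..} v) = 1 / 6"
  "mean (\<lambda>v. v\<^sup>2 * indicator {..<0} v) = 1 / 6"
proof -
  have "(\<lambda>v::real. indicator {-1..1} v *\<^sub>R (v\<^sup>2 * indicator {0<..} v)) = (\<lambda>v. v\<^sup>2 * indicator {0..1} v)"
    by (auto split: split_indicator)
  then show "mean (\<lambda>v. v\<^sup>2 * indicator {0<..} v) = 1 / 6"
    using integral_power[of 0 1 2] by (simp add: mean_def set_lebesgue_integral_def)
  have "(\<lambda>v::real. indicator {-1..1} v *\<^sub>R (v\<^sup>2 * indicator {..<0} v)) = (\<lambda>v. v\<^sup>2 * indicator {-1..0} v)"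
    by (auto split: split_indicator)
  then show "mean (\<lambda>v. v\<^sup>2 * indicator {..<0} v) = 1 / 6"
    using integral_power[of "-1" 0 2] by (simp add: mean_def set_lebesgue_integral_def)
qed

section \<open>The flux coefficients for small mean free path\<close>

text \<open>
  Everything depends on \<open>d = \<epsilon>\<^sup>2\<nu> = s + a\<epsilon>\<^sup>2\<close>, which stays above \<open>s/2\<close>, and on the exponent
  \<open>x = \<nu>h\<close>, which is at least \<open>s0 h / (2\<epsilon>\<^sup>2)\<close>. With \<open>e = exp (- x)\<close>, \<open>y = (1 - e)/x\<close> and
  \<open>q = s/d\<close> the coefficients are rational expressions in which \<open>q\<close> is close to 1 while \<open>e\<close>
  and \<open>y\<close> are at most \<open>1/x\<close>. The opacity \<open>s\<close> is only bounded from below, so the error of \<open>D\<close>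
  is measured relative to its limit \<open>- 1/s\<close>: the bound on \<open>s D + 1\<close> is uniform in all \<open>s \<ge> s0\<close>.
  The coefficient \<open>C\<close> genuinely blows up like \<open>1/\<epsilon>\<close>.
\<close>

lemma coef_bounds:
  fixes h eps s a s0 K :: real
  assumes h: "0 < h" and eps: "0 < eps" and s0: "0 < s0" "s0 \<le> s"
    and a: "\<bar>a\<bar> \<le> K" and small: "K * eps\<^sup>2 \<le> s0 / 2"
  shows "\<bar>coefA h eps s a\<bar> \<le> 2 * eps / (h * s0)"
    and "\<bar>coefC h eps s a\<bar> \<le> 2 / eps"
    and "\<bar>s * coefD h eps s a + 1\<bar> \<le> (6 * K + 16 / h) * eps\<^sup>2 / s0"
    and "\<bar>coefE h eps s a\<bar> \<le> 2 * eps / s0"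
proof -
  define d where "d = s + a * eps\<^sup>2"
  define x where "x = nu eps s a * h"
  define e where "e = exp (- x)"
  define y where "y = (1 - e) / x"
  define q where "q = s / d"
  have e2: "0 < eps\<^sup>2" using eps by simp
  have "\<bar>a * eps\<^sup>2\<bar> \<le> K * eps\<^sup>2"
    using a e2 by (simp add: abs_mult mult_right_mono)
  then have ae: "\<bar>a * eps\<^sup>2\<bar> \<le> s0 / 2" "\<bar>a * eps\<^sup>2\<bar> \<le> K * eps\<^sup>2" using small by linarith+
  have d: "s / 2 \<le> d" "s0 / 2 \<le> d" "0 < d" using ae s0 unfolding d_def by linarith+
  have nu: "nu eps s a = d / eps\<^sup>2"
    using eps by (simp add: nu_def d_def field_simps)
  have x: "x = d * h / eps\<^sup>2" by (simp add: x_def nu)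
  have x0: "0 < x" using d h e2 by (simp add: x)
  have e01: "0 < e" "e < 1" using x0 by (auto simp: e_def)
  have y0: "0 < y" using e01 x0 by (simp add: y_def)
  have "1 - e \<le> x" using exp_ge_add_one_self[of "-x"] by (simp add: e_def)
  then have y1: "y \<le> 1" using x0 by (simp add: y_def)
  have yx: "y \<le> 1 / x" using e01 x0 by (simp add: y_def divide_right_mono)
  have "e * (1 + x) \<le> e * exp x" using e01 by (simp add: exp_ge_add_one_self)
  also have "e * exp x = 1" by (simp add: e_def flip: exp_add)
  finally have "e * x \<le> 1" using e01 by (simp add: algebra_simps)
  then have ex: "e \<le> 1 / x" using x0 by (simp add: field_simps)
  have rx: "1 / x \<le> 2 * eps\<^sup>2 / (s0 * h)"
  proof -
    have "s0 / 2 * h / eps\<^sup>2 \<le> x" unfolding x using d h e2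
      by (intro divide_right_mono mult_right_mono) auto
    then have "1 / x \<le> 1 / (s0 / 2 * h / eps\<^sup>2)" using s0 h e2 x0
      by (intro divide_left_mono) auto
    then show ?thesis by (simp add: mult_ac)
  qed
  have q: "0 \<le> q" "q \<le> 2" using d s0 by (auto simp: q_def divide_le_eq)
  have "q - 1 = - (a * eps\<^sup>2) / d" using d by (simp add: q_def d_def field_simps)
  then have "\<bar>q - 1\<bar> = \<bar>a * eps\<^sup>2\<bar> / d" using d by simp
  also have "\<dots> \<le> K * eps\<^sup>2 / (s0 / 2)" using ae d s0 by (intro frac_le) auto
  finally have q1: "\<bar>q - 1\<bar> \<le> 2 * K * eps\<^sup>2 / s0" by (simp add: mult_ac)
  have nuh: "exp (- nu eps s a * h) = e" by (simp add: e_def x_def)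
  have hd: "(1 - e) / nu eps s a = h * y" using d h e2 by (simp add: y_def x nu)
  have "\<bar>coefA h eps s a\<bar> = (1 - e) * eps / (h * d)"
    unfolding coefA_def nuh using d h eps e01 by (simp add: nu power2_eq_square field_simps abs_mult)
  also have "\<dots> \<le> 1 * eps / (h * (s0 / 2))"
    using d h eps e01 s0 by (intro frac_le mult_mono mult_right_mono mult_left_mono) auto
  finally show "\<bar>coefA h eps s a\<bar> \<le> 2 * eps / (h * s0)" by (simp add: mult_ac)
  have "coefC h eps s a = s / (h * eps ^ 3 * nu eps s a) * (h - (1 - e) / nu eps s a)"
    unfolding coefC_def nuh by simp
  also have "\<dots> = q * (1 - y) / eps"
    unfolding hd unfolding nu q_def using d h eps by (simp add: power2_eq_square power3_eq_cube field_simps)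
  finally have C: "coefC h eps s a = q * (1 - y) / eps" .
  have "q * (1 - y) \<le> 2 * 1" using q y0 y1 by (intro mult_mono) auto
  then show "\<bar>coefC h eps s a\<bar> \<le> 2 / eps"
    using C q y1 eps by (simp add: abs_mult divide_right_mono)
  have "coefE h eps s a = 1 / (h * eps * nu eps s a) * (h - (1 - e) / nu eps s a)"
    unfolding coefE_def nuh by simp
  also have "\<dots> = eps * (1 - y) / d"
    unfolding hd unfolding nu using d h eps by (simp add: power2_eq_square field_simps)
  finally have "\<bar>coefE h eps s a\<bar> = eps * (1 - y) / d"
    using d eps y1 by (simp add: abs_mult)
  also have "\<dots> \<le> eps * 1 / (s0 / 2)"
    using d eps y0 y1 s0 by (intro frac_le mult_left_mono) auto
  finally show "\<bar>coefE h eps s a\<bar> \<le> 2 * eps / s0" by (simp add: mult_ac)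
  have "s * coefD h eps s a
      = - (s\<^sup>2 / (h * eps ^ 4 * (nu eps s a)\<^sup>2)) * (h * (1 + e) - 2 * ((1 - e) / nu eps s a))"
    unfolding coefD_def nuh by (simp add: power2_eq_square)
  also have "\<dots> = - (q\<^sup>2) * (1 + (e - 2 * y))"
    unfolding hd unfolding nu q_def using d h eps
    by (simp add: power2_eq_square power4_eq_xxxx field_simps)
  finally have D: "s * coefD h eps s a + 1 = (1 - q) * (1 + q) - q\<^sup>2 * (e - 2 * y)"
    by (simp add: power2_eq_square algebra_simps)
  have "\<bar>(1 - q) * (1 + q)\<bar> \<le> (2 * K * eps\<^sup>2 / s0) * 3"
    unfolding abs_mult using q1 q by (intro mult_mono) auto
  moreover have "\<bar>q\<^sup>2 * (e - 2 * y)\<bar> \<le> 2\<^sup>2 * (2 * (2 * eps\<^sup>2 / (s0 * h)))"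
    unfolding abs_mult using q ex yx rx y0 e01 power_mono[OF q(2) q(1), of 2] by (intro mult_mono) auto
  ultimately have "\<bar>s * coefD h eps s a + 1\<bar>
      \<le> (2 * K * eps\<^sup>2 / s0) * 3 + 2\<^sup>2 * (2 * (2 * eps\<^sup>2 / (s0 * h)))"
    unfolding D by linarith
  also have "\<dots> = (6 * K + 16 / h) * eps\<^sup>2 / s0" using s0 h by (simp add: field_simps)
  finally show "\<bar>s * coefD h eps s a + 1\<bar> \<le> (6 * K + 16 / h) * eps\<^sup>2 / s0" .
qed

lemma coef_tendsto:
  assumes h: "0 < h" and s: "0 < s"
  shows "((\<lambda>eps. coefA h eps s a) \<longlongrightarrow> 0) (at_right 0)"
    and "((\<lambda>eps. coefD h eps s a) \<longlongrightarrow> - 1 / s) (at_right 0)"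
proof -
  have "((\<lambda>eps. \<bar>a\<bar> * eps\<^sup>2) \<longlongrightarrow> \<bar>a\<bar> * 0\<^sup>2) (at_right 0)" by (intro tendsto_intros)
  then have "\<forall>\<^sub>F eps in at_right 0. \<bar>a\<bar> * eps\<^sup>2 < s / 2"
    using s by (intro order_tendstoD) auto
  then have ev: "\<forall>\<^sub>F eps in at_right 0. 0 < eps \<and> \<bar>a\<bar> * eps\<^sup>2 \<le> s / 2"
    using eventually_at_right_less[of "0::real"] by eventually_elim auto
  have "((\<lambda>eps. 2 * eps / (h * s)) \<longlongrightarrow> 2 * 0 / (h * s)) (at_right 0)"
    by (intro tendsto_intros) (use h s in auto)
  then have "((\<lambda>eps. 2 * eps / (h * s)) \<longlongrightarrow> 0) (at_right 0)" by simp
  then show "((\<lambda>eps. coefA h eps s a) \<longlongrightarrow> 0) (at_right 0)"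
    by (rule Lim_null_comparison[rotated])
       (use ev in eventually_elim, use coef_bounds(1)[OF h _ s order_refl order_refl] in auto)
  have "((\<lambda>eps. (6 * \<bar>a\<bar> + 16 / h) * eps\<^sup>2 / s) \<longlongrightarrow> (6 * \<bar>a\<bar> + 16 / h) * 0\<^sup>2 / s) (at_right 0)"
    by (intro tendsto_intros) (use s in auto)
  then have "((\<lambda>eps. (6 * \<bar>a\<bar> + 16 / h) * eps\<^sup>2 / s) \<longlongrightarrow> 0) (at_right 0)" by simp
  then have "((\<lambda>eps. s * coefD h eps s a + 1) \<longlongrightarrow> 0) (at_right 0)"
    by (rule Lim_null_comparison[rotated])
       (use ev in eventually_elim, use coef_bounds(3)[OF h _ s order_refl order_refl] in auto)
  then have "((\<lambda>eps. ((s * coefD h eps s a + 1) - 1) / s) \<longlongrightarrow> (0 - 1) / s) (at_right 0)"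
    by (intro tendsto_intros) (use s in auto)
  then show "((\<lambda>eps. coefD h eps s a) \<longlongrightarrow> - 1 / s) (at_right 0)" using s by simp
qed

section \<open>A discrete elliptic operator on bounded sequences\<close>

text \<open>
  The discrete operator \<open>b u - (k u')'\<close>, where \<open>k i\<close> lives at the interface between the cells
  \<open>i\<close> and \<open>i + 1\<close>. One time step of the modified scheme and one of the diffusion scheme both
  invert an operator of this kind.
\<close>

definition elliptic :: "(int \<Rightarrow> real) \<Rightarrow> (int \<Rightarrow> real) \<Rightarrow> (int \<Rightarrow> real) \<Rightarrow> int \<Rightarrow> real" where
  "elliptic b k u i = b i * u i - (k i * (u (i + 1) - u i) - k (i - 1) * (u i - u (i - 1)))"

lemma elliptic_diff:
  "elliptic b k u i - elliptic b k w i = elliptic b k (\<lambda>j. u j - w j) i"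
  by (simp add: elliptic_def algebra_simps)

text \<open>
  A weighted average of \<open>g/c\<close> (weight \<open>c\<close>) and of \<open>S \<ge> g/c\<close> (weight \<open>p\<close>) grows with the
  weight \<open>p\<close>, so \<open>p\<close> may be replaced by its upper bound \<open>B\<close>. This turns the row-wise diagonal
  dominance of the operator into one contraction factor for all rows.
\<close>

lemma weighted_step:
  fixes b c p g S B y :: real
  assumes "0 < c" "c \<le> b" "0 \<le> p" "p \<le> B" "g \<le> c * S" "0 \<le> S" "0 \<le> y"
    and "(b + p) * y \<le> g + p * S"
  shows "y \<le> (g + B * S) / (c + B)"
proof -
  have "(c + p) * y \<le> (b + p) * y" using assms by (intro mult_right_mono) auto
  then have 1: "(c + p) * y \<le> g + p * S" using assms by linarith
  have 2: "y \<le> S"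
  proof -
    have "(c + p) * y \<le> (c + p) * S" using 1 assms(5) by (simp add: algebra_simps)
    then show ?thesis using assms by simp
  qed
  have "(B - p) * y \<le> (B - p) * S" using 2 assms by (intro mult_left_mono) auto
  then have "(c + B) * y \<le> g + B * S" using 1 by (simp add: algebra_simps)
  then show ?thesis using assms by (simp add: field_simps)
qed

text \<open>
  On an infinite grid \<open>\<bar>u\<bar>\<close> need not attain its supremum \<open>S\<close>. Instead, if \<open>c S > g\<close>, every row bounds \<open>\<bar>u j\<bar>\<close> by one fixed number below \<open>S\<close>, which
  contradicts the choice of \<open>S\<close>.
\<close>

lemma elliptic_max_principle:
  assumes c: "0 < c" "\<And>i. c \<le> b i" and k: "\<And>i. 0 \<le> k i" "\<And>i. k i \<le> B"
    and u: "bounded (range u)" and g: "\<And>i. \<bar>elliptic b k u i\<bar> \<le> g"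
  shows "c * \<bar>u i\<bar> \<le> g"
proof -
  define S where "S = (SUP j. \<bar>u j\<bar>)"
  obtain U where "\<And>j. \<bar>u j\<bar> \<le> U" using u by (auto simp: bounded_iff)
  then have "bdd_above (range (\<lambda>j. \<bar>u j\<bar>))" by (auto intro!: bdd_aboveI)
  then have S: "\<bar>u j\<bar> \<le> S" for j unfolding S_def by (rule cSUP_upper[OF UNIV_I])
  have S0: "0 \<le> S" using S[of 0] by linarith
  have B0: "0 \<le> B" using k[of 0] by linarith
  have step: "(b j + (k j + k (j - 1))) * \<bar>u j\<bar> \<le> g + (k j + k (j - 1)) * S" for j
  proof -
    have "(b j + (k j + k (j - 1))) * \<bar>u j\<bar> = \<bar>(b j + (k j + k (j - 1))) * u j\<bar>"
      using c(2)[of j] c(1) k(1)[of j] k(1)[of "j - 1"] by (simp add: abs_mult)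
    also have "(b j + (k j + k (j - 1))) * u j
        = elliptic b k u j + k j * u (j + 1) + k (j - 1) * u (j - 1)"
      by (simp add: elliptic_def algebra_simps)
    also have "\<bar>\<dots>\<bar> \<le> \<bar>elliptic b k u j\<bar> + \<bar>k j * u (j + 1)\<bar> + \<bar>k (j - 1) * u (j - 1)\<bar>"
      by linarith
    also have "\<dots> \<le> g + k j * S + k (j - 1) * S"
      unfolding abs_mult using g[of j] k(1) S
      by (intro add_mono mult_mono) auto
    finally show ?thesis by (simp add: algebra_simps)
  qed
  have "c * S \<le> g"
  proof (rule ccontr)
    assume "\<not> c * S \<le> g"
    then have gS: "g < c * S" by simp
    have "\<bar>u j\<bar> \<le> (g + 2 * B * S) / (c + 2 * B)" for j
      by (rule weighted_step[where b="b j" and p="k j + k (j - 1)"])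
        (use c k[of j] k[of "j - 1"] gS S0 step[of j] in auto)
    then have "S \<le> (g + 2 * B * S) / (c + 2 * B)"
      unfolding S_def by (intro cSUP_least) auto
    then have "S * (c + 2 * B) \<le> g + 2 * B * S" using c B0 by (simp add: field_simps)
    then show False using gS by (simp add: algebra_simps)
  qed
  moreover have "c * \<bar>u i\<bar> \<le> c * S" using S c by simp
  ultimately show ?thesis by linarith
qed

text \<open>
  The Jacobi iteration, which solves each row for its diagonal entry, contracts the supremum
  norm by the factor \<open>2 B / (c + 2 B)\<close>. Since \<open>b\<close> may be unbounded, the uniform factor comes
  from the lower bound \<open>c\<close> alone.
\<close>

lemma elliptic_solvable:
  assumes c: "0 < c" "\<And>i. c \<le> b i" and k: "\<And>i. 0 \<le> k i" "\<And>i. k i \<le> B"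
    and w: "bounded (range w)"
  shows "\<exists>u. bounded (range u) \<and> (\<forall>i. elliptic b k u i = w i)"
proof -
  define m where "m i = b i + (k i + k (i - 1))" for i
  have B0: "0 \<le> B" using k[of 0] by linarith
  have m: "0 < m i" "c \<le> m i" "k i + k (i - 1) \<le> m i" for i
    using c(1) c(2)[of i] k(1)[of i] k(1)[of "i - 1"] unfolding m_def by linarith+
  define T where "T u = (\<lambda>i. (w i + k i * u (i + 1) + k (i - 1) * u (i - 1)) / m i)"
    for u :: "int \<Rightarrow> real"
  obtain W where W: "\<And>i. \<bar>w i\<bar> \<le> W" using w by (auto simp: bounded_iff)
  have avg: "\<bar>k i * x + k (i - 1) * y\<bar> \<le> (k i + k (i - 1)) * U" if "\<bar>x\<bar> \<le> U" "\<bar>y\<bar> \<le> U" for i x y U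
  proof -
    have "\<bar>k i * x + k (i - 1) * y\<bar> \<le> \<bar>k i * x\<bar> + \<bar>k (i - 1) * y\<bar>" by linarith
    also have "\<dots> \<le> k i * U + k (i - 1) * U"
      unfolding abs_mult using k(1) that by (intro add_mono mult_mono) auto
    finally show ?thesis by (simp add: algebra_simps)
  qed
  define q where "q = 2 * B / (c + 2 * B)"
  have q: "0 \<le> q" "q < 1" using c B0 by (auto simp: q_def)
  have contract: "\<bar>T u i - T v i\<bar> \<le> q * D" if "\<And>j. \<bar>u j - v j\<bar> \<le> D" for u v D i
  proof -
    have "T u i - T v i = (k i * (u (i + 1) - v (i + 1)) + k (i - 1) * (u (i - 1) - v (i - 1))) / m i"
      unfolding T_def by (simp add: algebra_simps flip: diff_divide_distrib)
    then have "m i * \<bar>T u i - T v i\<bar> = \<bar>k i * (u (i + 1) - v (i + 1)) + k (i - 1) * (u (i - 1) - v (i - 1))\<bar>"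
      using m(1)[of i] by (simp add: abs_divide)
    also have "\<dots> \<le> (k i + k (i - 1)) * D" by (rule avg[OF that that])
    finally have "\<bar>T u i - T v i\<bar> \<le> (0 + 2 * B * D) / (c + 2 * B)"
      using c k[of i] k[of "i - 1"] abs_ge_zero[THEN order_trans, OF that[of 0]] unfolding m_def
      by (intro weighted_step[where b="b i" and p="k i + k (i - 1)"]) auto
    then show ?thesis by (simp add: q_def)
  qed
  define x where "x n = (T ^^ n) (\<lambda>_. 0)" for n
  have x: "x 0 = (\<lambda>_. 0)" "x (Suc n) = T (x n)" for n by (auto simp: x_def)
  have W0: "0 \<le> W" using W[of 0] by linarith
  have incr: "\<bar>x (Suc n) i - x n i\<bar> \<le> q ^ n * (W / c)" for n i
  proof (induction n arbitrary: i)
    case 0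
    have "\<bar>w i\<bar> / m i \<le> W / c" using W[of i] m(1,2)[of i] c by (intro frac_le) auto
    then show ?case using m(1)[of i] by (simp add: x T_def abs_divide)
  next
    case (Suc n)
    show ?case using contract[OF Suc] by (simp add: x mult.assoc)
  qed
  have xS: "\<bar>x n i\<bar> \<le> W / c" for n i
  proof (induction n arbitrary: i)
    case 0
    then show ?case using W0 c by (simp add: x)
  next
    case (Suc n)
    have "m i * \<bar>T (x n) i\<bar> = \<bar>w i + (k i * x n (i + 1) + k (i - 1) * x n (i - 1))\<bar>"
      unfolding T_def using m(1)[of i] by (simp add: abs_divide add.assoc)
    also have "\<dots> \<le> W + (k i + k (i - 1)) * (W / c)"
      using W[of i] avg[OF Suc Suc, of i "i + 1" "i - 1"] by linarith
    finally have "\<bar>T (x n) i\<bar> \<le> (W + 2 * B * (W / c)) / (c + 2 * B)"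
      using c k[of i] k[of "i - 1"] W0 unfolding m_def
      by (intro weighted_step[where b="b i" and p="k i + k (i - 1)"]) auto
    also have "\<dots> = (W / c) * (c + 2 * B) / (c + 2 * B)" using c by (simp add: algebra_simps)
    also have "\<dots> = W / c" using c B0 by simp
    finally show ?case by (simp add: x)
  qed
  define u where "u i = lim (\<lambda>n. x n i)" for i
  have lim: "(\<lambda>n. x n i) \<longlonglongrightarrow> u i" for i
  proof -
    have "summable (\<lambda>n. q ^ n * (W / c))" using q by (intro summable_mult2 summable_geometric) auto
    then have "summable (\<lambda>n. x (Suc n) i - x n i)"
      by (rule summable_comparison_test'[of _ 0]) (use incr in auto)
    then have "convergent (\<lambda>n. \<Sum>j<n. x (Suc j) i - x j i)" by (simp add: summable_iff_convergent)
    then have "convergent (\<lambda>n. x n i)" by (simp only: sum_lessThan_telescope[of "\<lambda>n. x n i"] x(1) diff_0_right)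
    then show ?thesis by (simp add: u_def convergent_LIMSEQ_iff)
  qed
  have "T u i = u i" for i
  proof (rule LIMSEQ_unique)
    show "(\<lambda>n. x (Suc n) i) \<longlonglongrightarrow> T u i"
      unfolding x T_def by (intro tendsto_intros lim) (use m(1)[of i] in auto)
    show "(\<lambda>n. x (Suc n) i) \<longlonglongrightarrow> u i" using lim by (rule LIMSEQ_Suc)
  qed
  then have "u i * m i = w i + k i * u (i + 1) + k (i - 1) * u (i - 1)" for i
    unfolding T_def using m(1)[of i] by (metis nonzero_eq_divide_eq order_less_irrefl)
  then have "elliptic b k u i = w i" for i
    unfolding elliptic_def m_def by (simp add: algebra_simps)
  moreover have "\<bar>u i\<bar> \<le> W / c" for i
    by (rule LIMSEQ_le_const2[OF tendsto_rabs[OF lim]]) (use xS in auto)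
  then have "bounded (range u)" by (auto simp: bounded_iff)
  ultimately show ?thesis by blast
qed

section \<open>Both schemes as elliptic equations\<close>

definition streaming_flux :: "(nat \<Rightarrow> int \<Rightarrow> real \<Rightarrow> real) \<Rightarrow> nat \<Rightarrow> int \<Rightarrow> real" where
  "streaming_flux f n i = mean (\<lambda>v. v * upwind (f n i) (f n (i + 1)) v)"

lemma streaming_flux_bound:
  assumes "kinetic_bound M (f n i)" "kinetic_bound M (f n (i + 1))"
  shows "\<bar>streaming_flux f n i\<bar> \<le> M"
  unfolding streaming_flux_def
  by (intro mean_bound kinetic_bound_velocity kinetic_bound_upwind assms)

lemma rho_face_bound:
  assumes "kinetic_bound M (f n i)" "kinetic_bound M (f n (i + 1))"
  shows "\<bar>rho_face f n i\<bar> \<le> M"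
  unfolding rho_face_def by (intro mean_bound kinetic_bound_upwind assms)

text \<open>
  The flux is regrouped into constant multiples of four velocity profiles, so that
  averages and bounds can be taken term by term. Both slopes together form an upwind state.
\<close>

lemma micro_flux_split:
  "micro_flux P eps rho f n i = (\<lambda>v.
     coefA (dt P) eps (sigma_face P i) (alpha_face P i) * (v * upwind (f n i) (f n (i + 1)) v)
   + (coefC (dt P) eps (sigma_face P i) (alpha_face P i) * rho_face f n i) * (v * 1)
   + coefD (dt P) eps (sigma_face P i) (alpha_face P i) *
       (v * (v * upwind (\<lambda>_. slopeL P rho f n i) (\<lambda>_. slopeR P rho f n i) v))
   + (coefE (dt P) eps (sigma_face P i) (alpha_face P i) * G_face P i) * (v * 1))"
  by (rule ext) (simp add: micro_flux_def upwind_def power2_eq_square algebra_simps)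

lemma micro_flux_kinetic_bound:
  assumes f: "kinetic_bound M (f n i)" "kinetic_bound M (f n (i + 1))"
    and rho: "\<bar>rho (n + 1) i\<bar> \<le> R" "\<bar>rho (n + 1) (i + 1)\<bar> \<le> R"
    and G: "\<bar>G_face P i\<bar> \<le> Gam" and dx: "0 < dx P"
  shows "kinetic_bound
     (\<bar>coefA (dt P) eps (sigma_face P i) (alpha_face P i)\<bar> * M
    + \<bar>coefC (dt P) eps (sigma_face P i) (alpha_face P i)\<bar> * M
    + \<bar>coefD (dt P) eps (sigma_face P i) (alpha_face P i)\<bar> * (2 * (M + R) / dx P)
    + \<bar>coefE (dt P) eps (sigma_face P i) (alpha_face P i)\<bar> * Gam) (micro_flux P eps rho f n i)"
proof -
  have face: "\<bar>rho_face f n i\<bar> \<le> M" using f by (rule rho_face_bound)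
  have slope: "\<bar>slopeL P rho f n i\<bar> \<le> 2 * (M + R) / dx P" "\<bar>slopeR P rho f n i\<bar> \<le> 2 * (M + R) / dx P"
    using face rho dx unfolding slopeL_def slopeR_def
    by (auto simp: abs_divide intro!: divide_right_mono)
  have const: "kinetic_bound N (\<lambda>_. y)" if "\<bar>y\<bar> \<le> N" for y N
    using kinetic_bound_const that by (rule kinetic_bound_mono)
  have one: "kinetic_bound 1 (\<lambda>v. v * 1)" by (intro kinetic_bound_velocity const) simp
  have scale_one: "kinetic_bound (\<bar>a\<bar> * N) (\<lambda>v. (a * y) * (v * 1))" if "\<bar>y\<bar> \<le> N" for a y N :: real
    by (rule kinetic_bound_mono[OF kinetic_bound_scale[OF one]])
       (use that in \<open>simp add: abs_mult mult_left_mono\<close>)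
  show ?thesis unfolding micro_flux_split
    by (intro kinetic_bound_add kinetic_bound_scale kinetic_bound_velocity kinetic_bound_upwind
        scale_one f face slope G const)
qed

text \<open>
  Averaging removes the terms with \<open>C\<close> and \<open>E\<close>, which are odd in \<open>v\<close>; this is why the blow-up of
  \<open>C\<close> is harmless for the densities. The two half moments of \<open>v\<^sup>2\<close> are equal, so only the sum
  of the two slopes survives, and the interface density drops out of it. What remains is
  a centred difference of the densities at the new time level.
\<close>

lemma macro_flux_eq:
  assumes f: "kinetic_bound M (f n i)" "kinetic_bound M (f n (i + 1))" and dx: "0 < dx P"
  shows "macro_flux P eps rho f n i
     = coefA (dt P) eps (sigma_face P i) (alpha_face P i) * streaming_flux f n i
     + coefD (dt P) eps (sigma_face P i) (alpha_face P i) / (3 * dx P)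
         * (rho (n + 1) (i + 1) - rho (n + 1) i)"
proof -
  note const = kinetic_bound_const
  have up: "kinetic_bound M (\<lambda>v. v * upwind (f n i) (f n (i + 1)) v)"
    by (intro kinetic_bound_velocity kinetic_bound_upwind f)
  have one: "kinetic_bound \<bar>1\<bar> (\<lambda>v. v * 1)" by (intro kinetic_bound_velocity const)
  have half: "kinetic_bound 1 (\<lambda>v. v\<^sup>2 * indicator {0<..} v)" "kinetic_bound 1 (\<lambda>v. v\<^sup>2 * indicator {..<0} v)"
    by (auto intro!: kinetic_bound_borel split: split_indicator simp: abs_square_le_1)
  let ?L = "slopeL P rho f n i" and ?R = "slopeR P rho f n i"
  have sq: "(\<lambda>v. v * (v * upwind (\<lambda>_. ?L) (\<lambda>_. ?R) v))
      = (\<lambda>v. ?L * (v\<^sup>2 * indicator {0<..} v) + ?R * (v\<^sup>2 * indicator {..<0} v))"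
    by (rule ext) (simp add: upwind_def power2_eq_square algebra_simps)
  have half': "mean (\<lambda>v. v * (v * upwind (\<lambda>_. ?L) (\<lambda>_. ?R) v)) = (?L + ?R) / 6"
    unfolding sq by (subst mean_add[OF half[THEN kinetic_bound_scale]])
      (simp add: mean_scale mean_half_square)
  have sqb: "kinetic_bound (\<bar>?L\<bar> * 1 + \<bar>?R\<bar> * 1) (\<lambda>v. v * (v * upwind (\<lambda>_. ?L) (\<lambda>_. ?R) v))"
    unfolding sq by (intro kinetic_bound_add kinetic_bound_scale half)
  have "?L + ?R = (rho (n + 1) (i + 1) - rho (n + 1) i) / (dx P / 2)"
    by (simp add: slopeL_def slopeR_def flip: add_divide_distrib)
  then have LR: "(?L + ?R) / 6 = 1 / (3 * dx P) * (rho (n + 1) (i + 1) - rho (n + 1) i)"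
    using dx by (simp only:) (simp add: field_simps)
  have add4: "mean (\<lambda>v. a * p v + b * q v + c * r v + d * q v)
      = a * mean p + b * mean q + c * mean r + d * mean q"
    if "kinetic_bound B1 p" "kinetic_bound B2 q" "kinetic_bound B3 r" for a b c d p q r B1 B2 B3
  proof -
    note sc = that[THEN kinetic_bound_scale]
    show ?thesis
      by (simp add: mean_add[OF kinetic_bound_add[OF kinetic_bound_add[OF sc(1) sc(2)] sc(3)] sc(2)]
          mean_add[OF kinetic_bound_add[OF sc(1) sc(2)] sc(3)] mean_add[OF sc(1) sc(2)] mean_scale)
  qed
  show ?thesis
    unfolding macro_flux_def micro_flux_split
    by (subst add4[OF up one sqb]) (simp add: half' LR mean_velocity streaming_flux_def)
qed

text \<open>
  The weights below are the numerical and the limit diffusion coefficients, multiplied by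
  \<open>\<Delta>t/\<Delta>x\<^sup>2\<close> so that a time step, once multiplied by \<open>\<Delta>t\<close>, is an equation for \<^const>\<open>elliptic\<close>.
\<close>

definition scheme_diffusivity :: "ugks_data \<Rightarrow> real \<Rightarrow> int \<Rightarrow> real" where
  "scheme_diffusivity P eps i =
     - (dt P * coefD (dt P) eps (sigma_face P i) (alpha_face P i) / (3 * (dx P)\<^sup>2))"

definition limit_diffusivity :: "ugks_data \<Rightarrow> int \<Rightarrow> real" where
  "limit_diffusivity P i = dt P / (3 * sigma_face P i * (dx P)\<^sup>2)"

definition streaming_source :: "ugks_data \<Rightarrow> real \<Rightarrow> (nat \<Rightarrow> int \<Rightarrow> real \<Rightarrow> real) \<Rightarrow> nat \<Rightarrow> int \<Rightarrow> real" where
  "streaming_source P eps f n i = dt P / dx P *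
     (coefA (dt P) eps (sigma_face P i) (alpha_face P i) * streaming_flux f n i
    - coefA (dt P) eps (sigma_face P (i - 1)) (alpha_face P (i - 1)) * streaming_flux f n (i - 1))"

abbreviation reaction :: "ugks_data \<Rightarrow> int \<Rightarrow> real" where
  "reaction P \<equiv> \<lambda>i. 1 + dt P * alpha_cell P i"

lemma scaled_residual: "(l - r) * h = L - R \<Longrightarrow> 0 < h \<Longrightarrow> l = r \<longleftrightarrow> L = R" for l r h L R :: real
  by (metis eq_iff_diff_eq_0 mult_eq_0_iff order_less_irrefl)

lemma macro_step_elliptic:
  assumes f: "\<And>j. j \<in> {i - 1..i + 1} \<Longrightarrow> kinetic_bound M (f n j)"
    and dx: "0 < dx P" and dt: "0 < dt P"
  shows "(rho (n + 1) i - rho n i) / dt P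
       + 1 / dx P * (macro_flux P eps rho f n i - macro_flux P eps rho f n (i - 1))
       = - alpha_cell P i * rho (n + 1) i + G_cell P i
     \<longleftrightarrow> elliptic (reaction P) (scheme_diffusivity P eps) (rho (n + 1)) i
       = rho n i + dt P * G_cell P i - streaming_source P eps f n i" (is "?l = ?r \<longleftrightarrow> ?L = ?R")
proof -
  have m: "macro_flux P eps rho f n i
     = coefA (dt P) eps (sigma_face P i) (alpha_face P i) * streaming_flux f n i
     + coefD (dt P) eps (sigma_face P i) (alpha_face P i) / (3 * dx P)
         * (rho (n + 1) (i + 1) - rho (n + 1) i)"
    using f dx by (intro macro_flux_eq[of M]) auto
  have m': "macro_flux P eps rho f n (i - 1)
     = coefA (dt P) eps (sigma_face P (i - 1)) (alpha_face P (i - 1)) * streaming_flux f n (i - 1)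
     + coefD (dt P) eps (sigma_face P (i - 1)) (alpha_face P (i - 1)) / (3 * dx P)
         * (rho (n + 1) i - rho (n + 1) (i - 1))"
    using macro_flux_eq[of M f n "i - 1" P eps rho] f dx by simp
  have alg: "((x1 - x0) / h + 1 / d * ((a + D / (3 * d) * (xr - x1)) - (a' + D' / (3 * d) * (x1 - xl)))
        - (- al * x1 + G)) * h
      = ((1 + h * al) * x1 - (- (h * D / (3 * d\<^sup>2)) * (xr - x1) - - (h * D' / (3 * d\<^sup>2)) * (x1 - xl)))
        - (x0 + h * G - h / d * (a - a'))"
    if "0 < h" "0 < d" for x1 x0 h d a D xr a' D' xl al G :: real
proof -
  define E E' where "E = D / (3 * d\<^sup>2)" and "E' = D' / (3 * d\<^sup>2)"
  have D: "D / (3 * d) = d * E" "D' / (3 * d) = d * E'" "h * D / (3 * d\<^sup>2) = h * E" "h * D' / (3 * d\<^sup>2) = h * E'"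
    using that by (auto simp: E_def E'_def power2_eq_square)
  have "1 / d * ((a + d * E * (xr - x1)) - (a' + d * E' * (x1 - xl)))
      = (a - a') / d + E * (xr - x1) - E' * (x1 - xl)"
    using that by (simp add: field_simps)
  then have rearranged: "1 / d * ((a + D / (3 * d) * (xr - x1)) - (a' + D' / (3 * d) * (x1 - xl)))
      = (a - a') / d + E * (xr - x1) - E' * (x1 - xl)"
    unfolding D .
  show ?thesis
    unfolding rearranged D using that by (simp add: algebra_simps diff_divide_distrib)
qed
  have "(?l - ?r) * dt P = ?L - ?R"
    unfolding m m' elliptic_def scheme_diffusivity_def streaming_source_def
    by (rule alg[OF dt dx])
  then show ?thesis using dt by (rule scaled_residual)
qed

lemma implicit_diffusion_step_elliptic:
  assumes dx: "0 < dx P" and dt: "0 < dt P"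
  shows "implicit_diffusion_step P r n i \<longleftrightarrow>
    elliptic (reaction P) (limit_diffusivity P) (r (n + 1)) i = r n i + dt P * G_cell P i"
    (is "_ \<longleftrightarrow> ?L = ?R")
proof -
  have alg: "((x1 - x0) / h - 1 / d * (1 / (3 * s) * ((xr - x1) / d) - 1 / (3 * s') * ((x1 - xl) / d))
        - (- al * x1 + G)) * h
      = ((1 + h * al) * x1 - (h / (3 * s * d\<^sup>2) * (xr - x1) - h / (3 * s' * d\<^sup>2) * (x1 - xl)))
        - (x0 + h * G)"
    if "0 < h" "0 < d" for x1 x0 h d s s' xr xl al G :: real
proof -
  have "(x1 - x0) / h * h = x1 - x0" using that by simp
  then show ?thesis by (simp add: algebra_simps power2_eq_square diff_divide_distrib)
qed
  show ?thesis
    unfolding implicit_diffusion_step_def elliptic_def limit_diffusivity_def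
    by (rule scaled_residual[OF alg[OF dt dx] dt])
qed

text \<open>
  The stiff relaxation is implicit but local, so the kinetic relation can be solved for the
  new distribution \<open>g'\<close> at each velocity. Taking averages gives an equation of the same form,
  hence the abstract real parameters.
\<close>

lemma kinetic_relation_solved:
  fixes l :: real
  assumes "l = 1 / h + th + al" "l \<noteq> 0"
  shows "(g' - g) / h + 1 / d * (p - q) = th * (u - g') - al * g' + G
    \<longleftrightarrow> g' = (1 / l) * ((1 / h) * g + (- 1 / d) * p + (1 / d) * q + (th * u + G))"
proof -
  have "(g' - g) / h + 1 / d * (p - q) - (th * (u - g') - al * g' + G)
      = l * g' - ((1 / h) * g + (- 1 / d) * p + (1 / d) * q + (th * u + G))"
    unfolding assms(1) by (simp add: diff_divide_distrib algebra_simps)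
  then have "(g' - g) / h + 1 / d * (p - q) = th * (u - g') - al * g' + G
      \<longleftrightarrow> l * g' = (1 / h) * g + (- 1 / d) * p + (1 / d) * q + (th * u + G)"
    by (metis eq_iff_diff_eq_0)
  also have "\<dots> \<longleftrightarrow> g' = (1 / l) * ((1 / h) * g + (- 1 / d) * p + (1 / d) * q + (th * u + G))"
    using assms(2) by (simp add: eq_divide_eq mult.commute)
  finally show ?thesis .
qed

section \<open>The limit of a single step\<close>

text \<open>
  In the elliptic form of the scheme the diffusivities converge, and the streaming source
  vanishes because \<open>A\<close> does and the distributions stay bounded. Passing to the limit in the
  equation gives the diffusion step.
\<close>

lemma modified_ugks_step_limit:
  fixes P :: ugks_data
  assumes dx: "0 < dx P" and dt: "0 < dt P" and sg: "\<And>i. 0 < sigma_face P i"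
    and step: "\<forall>\<^sub>F eps in at_right 0. modified_ugks_step P eps (rho eps) (f eps) n i"
    and bd: "\<forall>\<^sub>F eps in at_right 0. \<forall>j\<in>{i - 1..i + 1}. kinetic_bound M (f eps n j)"
    and lim0: "((\<lambda>eps. rho eps n i) \<longlongrightarrow> r n i) (at_right 0)"
    and lim1: "\<And>j. j \<in> {i - 1..i + 1} \<Longrightarrow> ((\<lambda>eps. rho eps (n + 1) j) \<longlongrightarrow> r (n + 1) j) (at_right 0)"
  shows "implicit_diffusion_step P r n i"
proof -
  have eq: "\<forall>\<^sub>F eps in at_right 0.
      elliptic (reaction P) (scheme_diffusivity P eps) (rho eps (n + 1)) i
      = rho eps n i + dt P * G_cell P i - streaming_source P eps (f eps) n i"
    using step bd
  proof eventually_elim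
    case (elim eps)
    then show ?case
      using macro_step_elliptic[OF _ dx dt, of i M "f eps" n "rho eps" eps]
      unfolding modified_ugks_step_def by blast
  qed
  have D: "((\<lambda>eps. scheme_diffusivity P eps j) \<longlongrightarrow> limit_diffusivity P j) (at_right 0)" for j
  proof -
    have "((\<lambda>eps. scheme_diffusivity P eps j) \<longlongrightarrow> - (dt P * (- 1 / sigma_face P j) / (3 * (dx P)\<^sup>2))) (at_right 0)"
      unfolding scheme_diffusivity_def by (intro tendsto_intros coef_tendsto dt sg) (use dx in auto)
    then show ?thesis by (simp add: limit_diffusivity_def mult_ac)
  qed
  have A: "((\<lambda>eps. coefA (dt P) eps (sigma_face P j) (alpha_face P j) * streaming_flux (f eps) n j) \<longlongrightarrow> 0) (at_right 0)"
    if j: "j \<in> {i - 1..i}" for j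
  proof (rule Lim_null_comparison)
    show "\<forall>\<^sub>F eps in at_right 0. norm (coefA (dt P) eps (sigma_face P j) (alpha_face P j) * streaming_flux (f eps) n j)
        \<le> \<bar>coefA (dt P) eps (sigma_face P j) (alpha_face P j)\<bar> * M"
      using bd
    proof eventually_elim
      case (elim eps)
      have "\<bar>streaming_flux (f eps) n j\<bar> \<le> M"
        by (rule streaming_flux_bound) (use elim j in auto)
      then show ?case by (simp add: abs_mult mult_left_mono)
    qed
    have "((\<lambda>eps. \<bar>coefA (dt P) eps (sigma_face P j) (alpha_face P j)\<bar> * M) \<longlongrightarrow> \<bar>0\<bar> * M) (at_right 0)"
      by (intro tendsto_intros coef_tendsto dt sg)
    then show "((\<lambda>eps. \<bar>coefA (dt P) eps (sigma_face P j) (alpha_face P j)\<bar> * M) \<longlongrightarrow> 0) (at_right 0)" by simp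
  qed
  have "((\<lambda>eps. elliptic (reaction P) (scheme_diffusivity P eps) (rho eps (n + 1)) i)
      \<longlongrightarrow> elliptic (reaction P) (limit_diffusivity P) (r (n + 1)) i) (at_right 0)"
    unfolding elliptic_def by (intro tendsto_intros D lim1) auto
  moreover have "((\<lambda>eps. rho eps n i + dt P * G_cell P i - streaming_source P eps (f eps) n i)
      \<longlongrightarrow> r n i + dt P * G_cell P i - dt P / dx P * (0 - 0)) (at_right 0)"
    unfolding streaming_source_def by (intro tendsto_intros A lim0) auto
  ultimately have "elliptic (reaction P) (limit_diffusivity P) (r (n + 1)) i = r n i + dt P * G_cell P i"
    using tendsto_unique[OF trivial_limit_at_right_real] tendsto_cong[OF eq] by auto
  then show ?thesis using dx dt by (simp add: implicit_diffusion_step_elliptic)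
qed

section \<open>Estimates uniform in the cell\<close>

text \<open>
  On an infinite grid, pointwise limits of the coefficients do not suffice; the constants of this
  locale make all estimates uniform in the cell.
\<close>

locale uniform_ugks =
  fixes P :: ugks_data and s0 K Gam c :: real
  assumes dx: "0 < dx P" and dt: "0 < dt P" and s0: "0 < s0" and c: "0 < c"
    and sigma_cell: "s0 \<le> sigma_cell P i" and sigma_face: "s0 \<le> sigma_face P i"
    and alpha_face: "\<bar>alpha_face P i\<bar> \<le> K"
    and G_cell: "\<bar>G_cell P i\<bar> \<le> Gam" and G_face: "\<bar>G_face P i\<bar> \<le> Gam"
    and reaction: "c \<le> reaction P i"
begin

text \<open>
  The last two inequalities are what the coefficient estimates ask for: the third keeps
  \<open>\<nu>\<close> positive, the fourth makes \<open>\<sigma> D + 1\<close> at most 1, hence \<open>D \<le> 0\<close>. Thus the numerical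
  diffusivities are nonnegative and the elliptic operator is diagonally dominant.
\<close>

definition small :: "real \<Rightarrow> bool" where
  "small eps \<longleftrightarrow> 0 < eps \<and> eps \<le> 1 \<and> K * eps\<^sup>2 \<le> s0 / 2 \<and> (6 * K + 16 / dt P) * eps\<^sup>2 \<le> s0"

lemma eventually_small: "\<forall>\<^sub>F eps in at_right 0. small eps"
proof -
  have lim: "((\<lambda>eps. a * eps\<^sup>2) \<longlongrightarrow> a * 0\<^sup>2) (at_right 0)" for a :: real by (intro tendsto_intros)
  have "\<forall>\<^sub>F eps in at_right 0. K * eps\<^sup>2 < s0 / 2"
    using order_tendstoD(2)[OF lim[of K], of "s0 / 2"] s0 by simp
  moreover have "\<forall>\<^sub>F eps in at_right 0. (6 * K + 16 / dt P) * eps\<^sup>2 < s0"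
    using order_tendstoD(2)[OF lim, of "6 * K + 16 / dt P" s0] s0 by simp
  moreover have "\<forall>\<^sub>F eps in at_right 0. eps \<in> {0<..<1::real}"
    by (rule eventually_at_right_real) simp
  ultimately show ?thesis by eventually_elim (auto simp: small_def)
qed

lemma K_nonneg: "0 \<le> K" using alpha_face[of 0] by linarith
lemma Gam_nonneg: "0 \<le> Gam" using G_cell[of 0] by linarith

lemma coefs_small:
  assumes "small eps"
  shows "\<bar>coefA (dt P) eps (sigma_face P i) (alpha_face P i)\<bar> \<le> 2 * eps / (dt P * s0)"
    and "\<bar>coefC (dt P) eps (sigma_face P i) (alpha_face P i)\<bar> \<le> 2 / eps"
    and "\<bar>coefE (dt P) eps (sigma_face P i) (alpha_face P i)\<bar> \<le> 2 * eps / s0"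
    and "- (2 / s0) \<le> coefD (dt P) eps (sigma_face P i) (alpha_face P i)"
    and "coefD (dt P) eps (sigma_face P i) (alpha_face P i) \<le> 0"
    and "\<bar>coefD (dt P) eps (sigma_face P i) (alpha_face P i) + 1 / sigma_face P i\<bar>
        \<le> (6 * K + 16 / dt P) * eps\<^sup>2 / s0\<^sup>2"
proof -
  let ?s = "sigma_face P i" and ?D = "coefD (dt P) eps (sigma_face P i) (alpha_face P i)"
  have s: "0 < ?s" "s0 \<le> ?s" using s0 sigma_face[of i] by linarith+
  have e: "0 < eps" "K * eps\<^sup>2 \<le> s0 / 2" "(6 * K + 16 / dt P) * eps\<^sup>2 \<le> s0"
    using assms by (auto simp: small_def)
  note b = coef_bounds[OF dt e(1) s0 s(2) alpha_face[of i] e(2)]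
  show "\<bar>coefA (dt P) eps ?s (alpha_face P i)\<bar> \<le> 2 * eps / (dt P * s0)"
    "\<bar>coefC (dt P) eps ?s (alpha_face P i)\<bar> \<le> 2 / eps"
    "\<bar>coefE (dt P) eps ?s (alpha_face P i)\<bar> \<le> 2 * eps / s0"
    using b by auto
  have "(6 * K + 16 / dt P) * eps\<^sup>2 / s0 \<le> 1" using e s0 by simp
  then have sD: "- 2 \<le> ?s * ?D" "?s * ?D \<le> 0" using b(3) by linarith+
  show D0: "?D \<le> 0" using sD(2) s(1) by (simp add: mult_le_0_iff)
  have "s0 * (- ?D) \<le> ?s * (- ?D)" using D0 s by (intro mult_right_mono) auto
  then have "- 2 \<le> s0 * ?D" using sD(1) by simp
  then show "- (2 / s0) \<le> ?D" using s0 by (simp add: field_simps)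
  have "?D + 1 / ?s = (?s * ?D + 1) / ?s" using s by (simp add: field_simps)
  then have "\<bar>?D + 1 / ?s\<bar> = \<bar>?s * ?D + 1\<bar> / ?s" using s by simp
  also have "\<dots> \<le> ((6 * K + 16 / dt P) * eps\<^sup>2 / s0) / s0"
    using b(3) s s0 by (intro frac_le order_trans[OF abs_ge_zero b(3)]) auto
  finally show "\<bar>?D + 1 / ?s\<bar> \<le> (6 * K + 16 / dt P) * eps\<^sup>2 / s0\<^sup>2"
    by (simp add: power2_eq_square)
qed

lemma scheme_diffusivity_range:
  assumes "small eps"
  shows "0 \<le> scheme_diffusivity P eps i" and "scheme_diffusivity P eps i \<le> 2 * dt P / (3 * s0 * (dx P)\<^sup>2)"
proof -
  let ?D = "coefD (dt P) eps (sigma_face P i) (alpha_face P i)"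
  have eq: "scheme_diffusivity P eps i = dt P * (- ?D) / (3 * (dx P)\<^sup>2)"
    by (simp add: scheme_diffusivity_def)
  show "0 \<le> scheme_diffusivity P eps i"
    unfolding eq using coefs_small(5)[OF assms, of i] dt dx
    by (intro divide_nonneg_pos mult_nonneg_nonneg) auto
  have "dt P * (- ?D) / (3 * (dx P)\<^sup>2) \<le> dt P * (2 / s0) / (3 * (dx P)\<^sup>2)"
    using coefs_small(4)[OF assms, of i] dt dx by (intro divide_right_mono mult_left_mono) auto
  then show "scheme_diffusivity P eps i \<le> 2 * dt P / (3 * s0 * (dx P)\<^sup>2)"
    unfolding eq by (simp add: mult_ac)
qed

lemma limit_diffusivity_range:
  "0 \<le> limit_diffusivity P i" "limit_diffusivity P i \<le> dt P / (3 * s0 * (dx P)\<^sup>2)"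
  using s0 sigma_face[of i] dt dx unfolding limit_diffusivity_def
  by (auto intro!: divide_left_mono mult_right_mono mult_pos_pos)

text \<open>
  The error is in fact of order \<open>\<epsilon>\<^sup>2\<close>; the streaming flux, which is only of order \<open>\<epsilon>\<close>, dominates.
\<close>

lemma diffusivity_error:
  assumes "small eps"
  shows "\<bar>scheme_diffusivity P eps i - limit_diffusivity P i\<bar>
    \<le> dt P / (3 * (dx P)\<^sup>2) * ((6 * K + 16 / dt P) / s0\<^sup>2) * eps"
proof -
  let ?D = "coefD (dt P) eps (sigma_face P i) (alpha_face P i)"
  have e: "0 < eps" "eps \<le> 1" using assms by (auto simp: small_def)
  have "scheme_diffusivity P eps i - limit_diffusivity P i
      = dt P / (3 * (dx P)\<^sup>2) * - (?D + 1 / sigma_face P i)"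
    by (simp add: scheme_diffusivity_def limit_diffusivity_def algebra_simps)
  then have "\<bar>scheme_diffusivity P eps i - limit_diffusivity P i\<bar>
      = dt P / (3 * (dx P)\<^sup>2) * \<bar>?D + 1 / sigma_face P i\<bar>"
    using dt dx by (simp only: abs_mult abs_minus_cancel) simp
  also have "\<dots> \<le> dt P / (3 * (dx P)\<^sup>2) * ((6 * K + 16 / dt P) * eps\<^sup>2 / s0\<^sup>2)"
    using dt dx by (intro mult_left_mono coefs_small assms) auto
  also have "\<dots> = dt P / (3 * (dx P)\<^sup>2) * ((6 * K + 16 / dt P) / s0\<^sup>2) * eps\<^sup>2" by simp
  also have "\<dots> \<le> dt P / (3 * (dx P)\<^sup>2) * ((6 * K + 16 / dt P) / s0\<^sup>2) * eps"
    using e dt dx K_nonneg by (intro mult_left_mono) (auto simp: power2_eq_square mult_left_le)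
  finally show ?thesis .
qed

lemma streaming_source_bound:
  assumes "small eps" and f: "\<And>j. kinetic_bound M (f n j)"
  shows "\<bar>streaming_source P eps f n i\<bar> \<le> 4 * M / (dx P * s0) * eps"
proof -
  let ?a = "\<lambda>j. coefA (dt P) eps (sigma_face P j) (alpha_face P j) * streaming_flux f n j"
  have a: "\<bar>?a j\<bar> \<le> 2 * eps / (dt P * s0) * M" for j
    unfolding abs_mult
    by (intro mult_mono' coefs_small[OF assms(1)] streaming_flux_bound f) auto
  have "\<bar>streaming_source P eps f n i\<bar> = dt P / dx P * \<bar>?a i - ?a (i - 1)\<bar>"
    unfolding streaming_source_def abs_mult using dt dx by simp
  also have "\<dots> \<le> dt P / dx P * (2 * (2 * eps / (dt P * s0) * M))"
    using a[of i] a[of "i - 1"] dt dx by (intro mult_left_mono) auto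
  also have "\<dots> = 4 * M / (dx P * s0) * eps" using dt dx s0 by simp
  finally show ?thesis .
qed

text \<open>
  For bounded data the microscopic flux is of size \<open>1/\<epsilon>\<close>, because of \<open>C\<close>. The stiffness of the
  relaxation is of size \<open>1/\<epsilon>\<^sup>2\<close> and more than compensates for it, so the new distribution stays
  bounded independently of \<open>\<epsilon>\<close>. These two functions record the resulting constants.
\<close>

definition flux_bound :: "real \<Rightarrow> real \<Rightarrow> real" where
  "flux_bound M R = 2 * M / (dt P * s0) + 2 * M + 4 * (M + R) / (s0 * dx P) + 2 * Gam / s0"

definition next_bound :: "real \<Rightarrow> real \<Rightarrow> real" where
  "next_bound M R = R + (M / dt P + 2 * flux_bound M R / dx P + Gam) / s0"

lemma micro_flux_small:
  assumes "small eps" and f: "\<And>j. kinetic_bound M (f n j)" and rho: "\<And>j. \<bar>rho (n + 1) j\<bar> \<le> R"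
  shows "kinetic_bound (flux_bound M R / eps) (micro_flux P eps rho f n i)"
proof (rule kinetic_bound_mono[OF micro_flux_kinetic_bound[where R=R and Gam=Gam]])
  have e: "0 < eps" "eps \<le> 1" using assms by (auto simp: small_def)
  have ee: "eps \<le> 1 / eps" using e by (simp add: le_divide_eq mult_le_one)
  have M: "0 \<le> M" using f kinetic_bound_nonneg by blast
  have R: "0 \<le> R" using rho[of 0] by linarith
  let ?p = "\<lambda>q. q (dt P) eps (sigma_face P i) (alpha_face P i) :: real"
  have "\<bar>?p coefA\<bar> \<le> 2 / (dt P * s0) * eps" using coefs_small(1)[OF assms(1)] by simp
  also have "\<dots> \<le> 2 / (dt P * s0) * (1 / eps)" using dt s0 ee by (intro mult_left_mono) auto
  finally have A: "\<bar>?p coefA\<bar> * M \<le> 2 / (dt P * s0) * (1 / eps) * M" using M by (rule mult_right_mono)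
  have C: "\<bar>?p coefC\<bar> * M \<le> 2 / eps * M" using coefs_small(2)[OF assms(1)] M by (rule mult_right_mono)
  have "\<bar>?p coefD\<bar> \<le> 2 / s0 * 1" using coefs_small(4,5)[OF assms(1), of i] by linarith
  also have "\<dots> \<le> 2 / s0 * (1 / eps)" using s0 e by (intro mult_left_mono) auto
  finally have D: "\<bar>?p coefD\<bar> * (2 * (M + R) / dx P) \<le> 2 / s0 * (1 / eps) * (2 * (M + R) / dx P)"
    using M R dx by (intro mult_right_mono) auto
  have "\<bar>?p coefE\<bar> \<le> 2 / s0 * eps" using coefs_small(3)[OF assms(1)] by simp
  also have "\<dots> \<le> 2 / s0 * (1 / eps)" using s0 ee by (intro mult_left_mono) auto
  finally have E: "\<bar>?p coefE\<bar> * Gam \<le> 2 / s0 * (1 / eps) * Gam" using Gam_nonneg by (rule mult_right_mono)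
  have "flux_bound M R / eps = 2 / (dt P * s0) * (1 / eps) * M + 2 / eps * M
      + 2 / s0 * (1 / eps) * (2 * (M + R) / dx P) + 2 / s0 * (1 / eps) * Gam"
    by (simp add: flux_bound_def add_divide_distrib ring_distribs mult_ac)
  then show "\<bar>?p coefA\<bar> * M + \<bar>?p coefC\<bar> * M + \<bar>?p coefD\<bar> * (2 * (M + R) / dx P) + \<bar>?p coefE\<bar> * Gam
      \<le> flux_bound M R / eps"
    using A C D E by linarith
qed (use f rho G_face dx in auto)

definition stiffness :: "real \<Rightarrow> int \<Rightarrow> real" where
  "stiffness eps i = 1 / dt P + sigma_cell P i / eps\<^sup>2 + alpha_cell P i"

lemma stiffness_bounds:
  assumes "small eps"
  shows "s0 / eps\<^sup>2 \<le> sigma_cell P i / eps\<^sup>2" "sigma_cell P i / eps\<^sup>2 \<le> stiffness eps i"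
    "0 < s0 / eps\<^sup>2" "0 < stiffness eps i"
proof -
  have "0 < eps" using assms by (simp add: small_def)
  then show 1: "s0 / eps\<^sup>2 \<le> sigma_cell P i / eps\<^sup>2" "0 < s0 / eps\<^sup>2"
    using sigma_cell[of i] s0 by (auto intro: divide_right_mono)
  have "1 / dt P + alpha_cell P i = reaction P i / dt P" using dt by (simp add: field_simps)
  also have "\<dots> > 0" using reaction[of i] c dt by simp
  finally show "sigma_cell P i / eps\<^sup>2 \<le> stiffness eps i" by (simp add: stiffness_def)
  then show "0 < stiffness eps i" using 1 by linarith
qed

definition kinetic_update ::
  "real \<Rightarrow> (nat \<Rightarrow> int \<Rightarrow> real) \<Rightarrow> (nat \<Rightarrow> int \<Rightarrow> real \<Rightarrow> real) \<Rightarrow> nat \<Rightarrow> int \<Rightarrow> real \<Rightarrow> real"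
where
  "kinetic_update eps rho f n i v = (1 / stiffness eps i) *
     ((1 / dt P) * f n i v + (- 1 / dx P) * micro_flux P eps rho f n i v
      + (1 / dx P) * micro_flux P eps rho f n (i - 1) v
      + (sigma_cell P i / eps\<^sup>2 * rho (n + 1) i + G_cell P i))"

lemma kinetic_relation_update:
  assumes "small eps"
  shows "(g - f n i v) / dt P
          + 1 / dx P * (micro_flux P eps rho f n i v - micro_flux P eps rho f n (i - 1) v)
          = sigma_cell P i / eps ^ 2 * (rho (n + 1) i - g) - alpha_cell P i * g + G_cell P i
     \<longleftrightarrow> g = kinetic_update eps rho f n i v"
  unfolding kinetic_update_def
  by (rule kinetic_relation_solved) (use stiffness_bounds(4)[OF assms, of i] in \<open>auto simp: stiffness_def\<close>)

text \<open>
  The relaxation term contributes a multiple of the new density with factor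
  \<open>(\<sigma>/\<epsilon>\<^sup>2) / stiffness \<le> 1\<close>, uniformly even for unbounded opacities; everything else is divided
  by at least \<open>s0/\<epsilon>\<^sup>2\<close>.
\<close>

lemma kinetic_update_bound:
  assumes "small eps" and f: "\<And>j. kinetic_bound M (f n j)" and rho: "\<And>j. \<bar>rho (n + 1) j\<bar> \<le> R"
  shows "kinetic_bound (next_bound M R) (kinetic_update eps rho f n i)"
proof -
  have e: "0 < eps" "eps \<le> 1" using assms by (auto simp: small_def)
  have M: "0 \<le> M" using f kinetic_bound_nonneg by blast
  have R: "0 \<le> R" using rho[of 0] by linarith
  define F where "F = flux_bound M R"
  have F: "0 \<le> F" unfolding F_def flux_bound_def using M R dt dx s0 Gam_nonneg by auto
  have phi: "kinetic_bound (F / eps) (micro_flux P eps rho f n j)" for j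
    unfolding F_def using assms by (intro micro_flux_small) auto
  define l th where "l = stiffness eps i" and "th = sigma_cell P i / eps\<^sup>2"
  have l: "s0 / eps\<^sup>2 \<le> l" "th \<le> l" "0 < l" "0 < s0 / eps\<^sup>2" "0 < th"
    using stiffness_bounds(1,2,4)[OF assms(1), of i] stiffness_bounds(3)[OF assms(1)] unfolding l_def th_def by linarith+
  have "kinetic_bound (\<bar>1 / l\<bar> * (\<bar>1 / dt P\<bar> * M + \<bar>- 1 / dx P\<bar> * (F / eps) + \<bar>1 / dx P\<bar> * (F / eps)
      + \<bar>th * rho (n + 1) i + G_cell P i\<bar>)) (kinetic_update eps rho f n i)"
    unfolding kinetic_update_def l_def th_def
    by (intro kinetic_bound_scale kinetic_bound_add f phi kinetic_bound_const)
  then show ?thesis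
  proof (rule kinetic_bound_mono)
    have "\<bar>th * rho (n + 1) i + G_cell P i\<bar> \<le> \<bar>th * rho (n + 1) i\<bar> + \<bar>G_cell P i\<bar>" by (rule abs_triangle_ineq)
    also have "\<dots> \<le> th * R + Gam"
      unfolding abs_mult using l rho[of i] G_cell[of i] by (intro add_mono mult_mono) auto
    finally have g: "\<bar>th * rho (n + 1) i + G_cell P i\<bar> \<le> th * R + Gam" .
    define X where "X = M / dt P + 2 * (F / eps) / dx P + Gam"
    have X: "0 \<le> X" unfolding X_def using M F e dt dx Gam_nonneg by simp
    have "\<bar>1 / l\<bar> * (\<bar>1 / dt P\<bar> * M + \<bar>- 1 / dx P\<bar> * (F / eps) + \<bar>1 / dx P\<bar> * (F / eps)
        + \<bar>th * rho (n + 1) i + G_cell P i\<bar>) \<le> 1 / l * (X + th * R)"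
      using l dt dx g by (simp add: X_def divide_right_mono)
    also have "\<dots> = X / l + th / l * R" using l by (simp add: field_simps)
    also have "\<dots> \<le> X / (s0 / eps\<^sup>2) + 1 * R"
      using l X R by (intro add_mono frac_le mult_right_mono) auto
    also have "X / (s0 / eps\<^sup>2) = (M / dt P * eps\<^sup>2 + 2 * F / dx P * eps + Gam * eps\<^sup>2) / s0"
      using e by (simp add: X_def ring_distribs power2_eq_square)
    also have "\<dots> \<le> (M / dt P * 1 + 2 * F / dx P * 1 + Gam * 1) / s0"
      using e M F dt dx Gam_nonneg s0
      by (intro divide_right_mono add_mono mult_left_mono) (auto simp: power_le_one)
    finally show "\<bar>1 / l\<bar> * (\<bar>1 / dt P\<bar> * M + \<bar>- 1 / dx P\<bar> * (F / eps) + \<bar>1 / dx P\<bar> * (F / eps)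
        + \<bar>th * rho (n + 1) i + G_cell P i\<bar>) \<le> next_bound M R"
      by (simp add: next_bound_def F_def)
  qed
qed

end

section \<open>Existence and uniqueness\<close>

text \<open>
  A step relates two consecutive time levels only. Restarting the clock at each step makes this
  explicit, and lets a solution be built by dependent choice.
\<close>

definition two_levels :: "'a \<Rightarrow> 'a \<Rightarrow> nat \<Rightarrow> 'a" where
  "two_levels x y n = (if n = 0 then x else y)"

lemma modified_ugks_step_two_levels:
  "modified_ugks_step P eps (\<lambda>n i. mean (f n i)) f n i
   \<longleftrightarrow> modified_ugks_step P eps (two_levels (\<lambda>i. mean (f n i)) (\<lambda>i. mean (f (n + 1) i)))
        (two_levels (f n) (f (n + 1))) 0 i"
  unfolding modified_ugks_step_def macro_flux_def micro_flux_def slopeL_def slopeR_def rho_face_def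
    two_levels_def by simp

context uniform_ugks
begin

lemma new_density_exists:
  assumes "small eps" "\<And>j. kinetic_bound M (f n j)"
  shows "\<exists>u. bounded (range u) \<and> (\<forall>i. elliptic (reaction P) (scheme_diffusivity P eps) u i
    = mean (f n i) + dt P * G_cell P i - streaming_source P eps f n i)"
proof (rule elliptic_solvable[where b="reaction P" and k="scheme_diffusivity P eps", OF c reaction scheme_diffusivity_range[OF assms(1)]])
  let ?S = "4 * M / (dx P * s0) * eps"
  have "\<bar>mean (f n i) + dt P * G_cell P i - streaming_source P eps f n i\<bar> \<le> M + dt P * Gam + ?S" for i
  proof -
    have "\<bar>dt P * G_cell P i\<bar> \<le> dt P * Gam"
      using dt G_cell[of i] by (simp add: abs_mult)
    then show ?thesis
      using mean_bound[OF assms(2), of i] streaming_source_bound[of eps M f n i, OF assms] by linarith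
  qed
  then show "bounded (range (\<lambda>i. mean (f n i) + dt P * G_cell P i - streaming_source P eps f n i))"
    unfolding bounded_iff by auto
qed

text \<open>
  The density comes from the elliptic equation and the distribution from the local kinetic
  relation. That the average of the new distribution is the new density is not imposed but
  follows: averaging the kinetic relation and subtracting the macroscopic one leaves
  \<open>stiffness * (mean - density) = 0\<close>.
\<close>

lemma step_exists:
  assumes sm: "small eps" and g: "\<And>j. kinetic_bound M (g j)"
  shows "\<exists>g' M'. (\<forall>i. kinetic_bound M' (g' i)) \<and>
    (\<forall>i. modified_ugks_step P eps (two_levels (\<lambda>i. mean (g i)) (\<lambda>i. mean (g' i))) (two_levels g g') 0 i)"
proof -
  define f where "f = (\<lambda>_::nat. g)"
  have f: "kinetic_bound M (f n j)" for n j by (simp add: f_def g)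
  obtain u where u: "bounded (range u)" and uL: "\<And>i. elliptic (reaction P) (scheme_diffusivity P eps) u i
    = mean (f 0 i) + dt P * G_cell P i - streaming_source P eps f 0 i"
    using new_density_exists[where f=f and n=0, OF sm f] by blast
  obtain R where R: "\<And>j. \<bar>u j\<bar> \<le> R" using u by (auto simp: bounded_iff)
  define rho where "rho = two_levels (\<lambda>i. mean (g i)) u"
  have rho: "rho 0 = (\<lambda>i. mean (g i))" "rho (0 + 1) = u" "rho (Suc 0) = u" by (simp_all add: rho_def two_levels_def)
  define g' where "g' = kinetic_update eps rho f 0"
  have g': "kinetic_bound (next_bound M R) (g' i)" for i
    unfolding g'_def by (rule kinetic_update_bound[where f=f and n=0 and M=M, OF sm f]) (simp add: rho R)
  have macro: "(rho (0 + 1) i - rho 0 i) / dt P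
       + 1 / dx P * (macro_flux P eps rho f 0 i - macro_flux P eps rho f 0 (i - 1))
       = - alpha_cell P i * rho (0 + 1) i + G_cell P i" for i
    by (subst macro_step_elliptic[where f=f and M=M, OF f dx dt]) (simp add: rho uL, simp add: f_def)
  have kin: "(g' i v - f 0 i v) / dt P
          + 1 / dx P * (micro_flux P eps rho f 0 i v - micro_flux P eps rho f 0 (i - 1) v)
          = sigma_cell P i / eps ^ 2 * (rho (0 + 1) i - g' i v) - alpha_cell P i * g' i v + G_cell P i" for i v
    unfolding kinetic_relation_update[OF sm] by (simp add: g'_def)
  have mean_g': "mean (g' i) = u i" for i
  proof -
    let ?l = "stiffness eps i" and ?th = "sigma_cell P i / eps\<^sup>2"
    have phi: "kinetic_bound (flux_bound M R / eps) (micro_flux P eps rho f 0 j)" for j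
      by (rule micro_flux_small[where f=f and n=0 and M=M, OF sm f]) (simp add: rho R)
    note sc = kinetic_bound_scale[OF f[of 0 i], of "1 / dt P"] kinetic_bound_scale[OF phi[of i], of "- 1 / dx P"]
      kinetic_bound_scale[OF phi[of "i - 1"], of "1 / dx P"] kinetic_bound_const[of "?th * rho (0 + 1) i + G_cell P i"]
    have "mean (g' i) = 1 / ?l * (1 / dt P * mean (f 0 i) + - 1 / dx P * macro_flux P eps rho f 0 i
      + 1 / dx P * macro_flux P eps rho f 0 (i - 1) + (?th * rho (0 + 1) i + G_cell P i))"
      unfolding g'_def kinetic_update_def mean_scale macro_flux_def
      by (simp only: mean_add[OF kinetic_bound_add[OF kinetic_bound_add[OF sc(1) sc(2)] sc(3)] sc(4)]
          mean_add[OF kinetic_bound_add[OF sc(1) sc(2)] sc(3)] mean_add[OF sc(1) sc(2)] mean_scale mean_const)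
    then have "(mean (g' i) - mean (f 0 i)) / dt P
       + 1 / dx P * (macro_flux P eps rho f 0 i - macro_flux P eps rho f 0 (i - 1))
       = ?th * (rho (0 + 1) i - mean (g' i)) - alpha_cell P i * mean (g' i) + G_cell P i"
      using stiffness_bounds(4)[OF sm, of i]
      by (subst kinetic_relation_solved[of ?l]) (auto simp: stiffness_def)
    with macro[of i] have relax: "(mean (g' i) - u i) / dt P = - (?th + alpha_cell P i) * (mean (g' i) - u i)"
      by (simp add: rho f_def diff_divide_distrib algebra_simps)
    have split: "?l * (mean (g' i) - u i)
        = (mean (g' i) - u i) / dt P + (?th + alpha_cell P i) * (mean (g' i) - u i)"
      by (simp add: stiffness_def distrib_right)
    have "?l * (mean (g' i) - u i) = 0"
      unfolding split relax by (simp only: mult_minus_left add.left_inverse)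
    then show ?thesis using stiffness_bounds(4)[OF sm, of i] by simp
  qed
  have "modified_ugks_step P eps rho (two_levels g g') 0 i" for i
  proof -
    have micro: "micro_flux P eps rho (two_levels g g') 0 = micro_flux P eps rho f 0"
      by (intro ext) (simp add: micro_flux_def slopeL_def slopeR_def rho_face_def two_levels_def f_def)
    show ?thesis
      unfolding modified_ugks_step_def macro_flux_def micro
      using macro[of i] kin[of i]
      by (simp add: macro_flux_def rho two_levels_def f_def)
  qed
  moreover have "rho = two_levels (\<lambda>i. mean (g i)) (\<lambda>i. mean (g' i))"
    by (simp add: rho_def mean_g')
  ultimately show ?thesis using g' by auto
qed

lemma solution_exists:
  assumes sm: "small eps" and f0: "\<And>i. kinetic_bound M (f0 i)"
  shows "\<exists>rho f. modified_ugks_solution P eps f0 rho f"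
proof -
  let ?step = "\<lambda>g g'. \<forall>i. modified_ugks_step P eps
      (two_levels (\<lambda>i. mean (g i)) (\<lambda>i. mean (g' i))) (two_levels g g') 0 i"
  have "\<exists>f. \<forall>n. ((n = 0 \<longrightarrow> f n = f0) \<and> (\<exists>M. \<forall>i. kinetic_bound M (f n i))) \<and> ?step (f n) (f (Suc n))"
  proof (rule dependent_nat_choice)
    show "\<exists>g. (0 = (0::nat) \<longrightarrow> g = f0) \<and> (\<exists>M. \<forall>i. kinetic_bound M (g i))" using f0 by blast
    show "\<exists>g'. ((Suc n = 0 \<longrightarrow> g' = f0) \<and> (\<exists>M. \<forall>i. kinetic_bound M (g' i))) \<and> ?step g g'"
      if "(n = 0 \<longrightarrow> g = f0) \<and> (\<exists>M. \<forall>i. kinetic_bound M (g i))" for g n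
    proof -
      from that obtain N where "\<And>i. kinetic_bound N (g i)" by blast
      from step_exists[where g=g and M=N, OF sm this] obtain g' N' where "\<forall>i. kinetic_bound N' (g' i)" "?step g g'" by blast
      then show ?thesis by blast
    qed
  qed
  then obtain f where f: "f 0 = f0" "\<And>n. \<exists>M. \<forall>i. kinetic_bound M (f n i)" "\<And>n. ?step (f n) (f (Suc n))"
    by blast
  have "modified_ugks_step P eps (\<lambda>n i. mean (f n i)) f n i" for n i
    using f(3)[of n] by (subst modified_ugks_step_two_levels) simp
  then have "modified_ugks_solution P eps f0 (\<lambda>n i. mean (f n i)) f"
    using f(1,2) by (simp add: modified_ugks_solution_def)
  then show ?thesis by blast
qed

lemma diffusion_solution_exists:
  assumes "bounded (range r0)"
  shows "\<exists>r. implicit_diffusion_solution P r0 r"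
proof -
  let ?step = "\<lambda>u u'. \<forall>i. elliptic (reaction P) (limit_diffusivity P) u' i = u i + dt P * G_cell P i"
  have "\<exists>r. \<forall>n. ((n = 0 \<longrightarrow> r n = r0) \<and> bounded (range (r n))) \<and> ?step (r n) (r (Suc n))"
  proof (rule dependent_nat_choice)
    show "\<exists>u. (0 = (0::nat) \<longrightarrow> u = r0) \<and> bounded (range u)" using assms by blast
    fix u n assume u: "(n = (0::nat) \<longrightarrow> u = r0) \<and> bounded (range u)"
    then obtain U where U: "\<And>i. \<bar>u i\<bar> \<le> U" by (auto simp: bounded_iff)
    have "\<bar>u i + dt P * G_cell P i\<bar> \<le> U + dt P * Gam" for i
    proof -
      have "\<bar>dt P * G_cell P i\<bar> \<le> dt P * Gam" using dt G_cell[of i] by (simp add: abs_mult)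
      then show ?thesis using U[of i] by linarith
    qed
    then have "bounded (range (\<lambda>i. u i + dt P * G_cell P i))" unfolding bounded_iff by auto
    from elliptic_solvable[where b="reaction P" and k="limit_diffusivity P", OF c reaction limit_diffusivity_range this]
    obtain u' where "bounded (range u')" "?step u u'" by blast
    then show "\<exists>u'. ((Suc n = 0 \<longrightarrow> u' = r0) \<and> bounded (range u')) \<and> ?step u u'" by blast
  qed
  then obtain r where r: "r 0 = r0" "\<And>n. bounded (range (r n))" "\<And>n. ?step (r n) (r (Suc n))" by blast
  have "implicit_diffusion_solution P r0 r"
    unfolding implicit_diffusion_solution_def implicit_diffusion_step_elliptic[OF dx dt]
    using r by simp
  then show ?thesis by blast
qed

lemma diffusion_solution_unique:
  assumes r: "implicit_diffusion_solution P r0 r" and r': "implicit_diffusion_solution P r0 r'"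
  shows "r = r'"
proof
  fix n show "r n = r' n"
  proof (induction n)
    case 0
    then show ?case using r r' by (simp add: implicit_diffusion_solution_def)
  next
    case (Suc n)
    note s = r[unfolded implicit_diffusion_solution_def implicit_diffusion_step_elliptic[OF dx dt]]
      r'[unfolded implicit_diffusion_solution_def implicit_diffusion_step_elliptic[OF dx dt]]
    have eq: "elliptic (reaction P) (limit_diffusivity P) (\<lambda>j. r (n + 1) j - r' (n + 1) j) i = 0" for i
      using s Suc by (simp flip: elliptic_diff)
    have bd: "bounded (range (\<lambda>j. r (n + 1) j - r' (n + 1) j))"
      using s by (intro bounded_minus_comp) auto
    have "c * \<bar>r (n + 1) i - r' (n + 1) i\<bar> \<le> 0" for i
      by (rule elliptic_max_principle[where b="reaction P" and k="limit_diffusivity P", OF c reaction limit_diffusivity_range bd]) (simp only: eq abs_zero order_refl)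
    then show ?case using c by (auto simp: mult_le_0_iff)
  qed
qed

section \<open>Convergence to the diffusion scheme\<close>

definition consistency_constant :: "real \<Rightarrow> real \<Rightarrow> real" where
  "consistency_constant M R = 4 * M / (dx P * s0)
     + 4 * R * (dt P / (3 * (dx P)\<^sup>2) * ((6 * K + 16 / dt P) / s0\<^sup>2))"

text \<open>
  The difference of the two densities solves the elliptic equation of the scheme with a source made
  of the old error, the streaming source, and the error of the diffusivities applied to the
  diffusion solution. The maximum principle then transfers these bounds to the difference.
\<close>

lemma step_error:
  assumes sm: "small eps" and f: "\<And>j. kinetic_bound M (f n j)"
    and step: "\<And>i. modified_ugks_step P eps rho f n i" and r: "\<And>i. implicit_diffusion_step P r n i"
    and err: "\<And>i. \<bar>rho n i - r n i\<bar> \<le> d"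
    and bd: "bounded (range (rho (n + 1)))" and R: "\<And>i. \<bar>r (n + 1) i\<bar> \<le> R"
  shows "c * \<bar>rho (n + 1) i - r (n + 1) i\<bar> \<le> d + consistency_constant M R * eps"
proof (rule elliptic_max_principle[where b="reaction P" and k="scheme_diffusivity P eps", OF c reaction scheme_diffusivity_range[OF sm]])
  have "bounded (range (r (n + 1)))" using R by (auto simp: bounded_iff)
  then show "bounded (range (\<lambda>i. rho (n + 1) i - r (n + 1) i))" using bd by (intro bounded_minus_comp)
  fix i
  let ?sch = "scheme_diffusivity P eps" and ?lim = "limit_diffusivity P" and ?r = "r (n + 1)"
  define q m where "q = dt P / (3 * (dx P)\<^sup>2) * ((6 * K + 16 / dt P) / s0\<^sup>2)" and "m = 4 * M / (dx P * s0)"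
  define e where "e j = ?sch j - ?lim j" for j
  have e: "\<bar>e j\<bar> \<le> q * eps" for j unfolding e_def q_def by (rule diffusivity_error[OF sm])
  have "elliptic (reaction P) ?sch (rho (n + 1)) i = rho n i + dt P * G_cell P i - streaming_source P eps f n i"
    using step[of i] macro_step_elliptic[where f=f and n=n and rho=rho and eps=eps and M=M and i=i, OF f dx dt]
    unfolding modified_ugks_step_def by blast
  moreover have "elliptic (reaction P) ?lim ?r i = r n i + dt P * G_cell P i"
    using r[of i] by (simp add: implicit_diffusion_step_elliptic[OF dx dt])
  moreover have "elliptic (reaction P) ?sch ?r i - elliptic (reaction P) ?lim ?r i
      = - (e i * (?r (i + 1) - ?r i) - e (i - 1) * (?r i - ?r (i - 1)))"
    by (simp add: elliptic_def e_def algebra_simps)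
  ultimately have eq: "elliptic (reaction P) ?sch (\<lambda>j. rho (n + 1) j - ?r j) i
      = (rho n i - r n i) - streaming_source P eps f n i
        + (e i * (?r (i + 1) - ?r i) - e (i - 1) * (?r i - ?r (i - 1)))"
    by (simp flip: elliptic_diff)
  have jump: "\<bar>e j * (?r k - ?r l)\<bar> \<le> q * eps * (2 * R)" for j k l
    unfolding abs_mult using e[of j] R[of k] R[of l] by (intro mult_mono) linarith+
  have "\<bar>elliptic (reaction P) ?sch (\<lambda>j. rho (n + 1) j - ?r j) i\<bar>
      \<le> d + m * eps + (q * eps * (2 * R) + q * eps * (2 * R))"
    unfolding eq using err[of i] streaming_source_bound[where f=f and n=n and i=i, OF sm f, folded m_def] jump[of i "i + 1" i] jump[of "i - 1" i "i - 1"]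
    by linarith
  also have "\<dots> = d + consistency_constant M R * eps"
    unfolding consistency_constant_def q_def[symmetric] m_def[symmetric] by (simp add: algebra_simps)
  finally show "\<bar>elliptic (reaction P) ?sch (\<lambda>j. rho (n + 1) j - ?r j) i\<bar> \<le> d + consistency_constant M R * eps" .
qed

text \<open>
  The bound on the distributions must be carried along in the induction: convergence of the densities at one level
  needs it at the level before, and in turn provides the bound on the densities from which
  the next distributions are estimated.
\<close>

lemma convergence:
  assumes f0: "\<forall>\<^sub>F eps in at_right 0. \<forall>i. kinetic_bound M0 (f0 eps i)"
    and init: "uniform_limit UNIV (\<lambda>eps i. mean (f0 eps i)) r0 (at_right 0)"
    and sol: "\<forall>\<^sub>F eps in at_right 0. modified_ugks_solution P eps (f0 eps) (rho eps) (f eps)"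
    and r: "implicit_diffusion_solution P r0 r"
  shows "uniform_limit UNIV (\<lambda>eps. rho eps n) (r n) (at_right 0) \<and>
    (\<exists>M. \<forall>\<^sub>F eps in at_right 0. \<forall>i. kinetic_bound M (f eps n i))"
proof (induction n)
  case 0
  have "\<forall>\<^sub>F eps in at_right 0. \<forall>i. kinetic_bound M0 (f eps 0 i)"
    using f0 sol
  proof eventually_elim
    case (elim eps)
    then show ?case unfolding modified_ugks_solution_def by (blast intro: kinetic_bound_cong)
  qed
  moreover have "\<forall>\<^sub>F eps in at_right 0. \<forall>i\<in>UNIV. rho eps 0 i = mean (f0 eps i)"
    using sol
  proof eventually_elim
    case (elim eps)
    then have "rho eps 0 i = mean (f eps 0 i)" "mean (f eps 0 i) = mean (f0 eps i)" for i
      unfolding modified_ugks_solution_def modified_ugks_step_def by (blast intro: mean_cong)+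
    then show ?case by simp
  qed
  then have "uniform_limit UNIV (\<lambda>eps. rho eps 0) (r 0) (at_right 0)
      = uniform_limit UNIV (\<lambda>eps i. mean (f0 eps i)) r0 (at_right 0)"
    using r by (intro uniform_limit_cong) (auto simp: implicit_diffusion_solution_def)
  ultimately show ?case using init by blast
next
  case (Suc n)
  then obtain M where lim: "uniform_limit UNIV (\<lambda>eps. rho eps n) (r n) (at_right 0)"
    and M: "\<forall>\<^sub>F eps in at_right 0. \<forall>i. kinetic_bound M (f eps n i)" by blast
  obtain R where R: "\<And>i. \<bar>r (n + 1) i\<bar> \<le> R"
    using r unfolding implicit_diffusion_solution_def bounded_iff by fastforce
  have lim': "uniform_limit UNIV (\<lambda>eps. rho eps (n + 1)) (r (n + 1)) (at_right 0)"
  proof (rule uniform_limitI)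
    fix d :: real assume d: "0 < d"
    let ?C = "consistency_constant M R"
    have "((\<lambda>eps. ?C * eps) \<longlongrightarrow> ?C * 0) (at_right 0)" by (intro tendsto_intros)
    then have C: "\<forall>\<^sub>F eps in at_right 0. ?C * eps < c * d / 2"
      using c d by (intro order_tendstoD(2)) auto
    have "\<forall>\<^sub>F eps in at_right 0. \<forall>i\<in>UNIV. dist (rho eps n i) (r n i) < c * d / 2"
      using c d by (intro uniform_limitD[OF lim]) auto
    then show "\<forall>\<^sub>F eps in at_right 0. \<forall>i\<in>UNIV. dist (rho eps (n + 1) i) (r (n + 1) i) < d"
      using C M sol eventually_small
    proof eventually_elim
      case (elim eps)
      obtain N where N: "\<And>i. kinetic_bound N (f eps (n + 1) i)"
        using elim(4) unfolding modified_ugks_solution_def by blast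
      have "rho eps (n + 1) i = mean (f eps (n + 1) i)" for i
        using elim(4) unfolding modified_ugks_solution_def modified_ugks_step_def by blast
      then have bd: "bounded (range (rho eps (n + 1)))"
        using mean_bound[OF N] by (auto simp: bounded_iff)
      have "c * \<bar>rho eps (n + 1) i - r (n + 1) i\<bar> \<le> c * d / 2 + ?C * eps" for i
      proof (rule step_error[where f="f eps" and rho="rho eps" and r=r and n=n and M=M and R=R
            and d="c * d / 2", OF elim(5) _ _ _ _ bd R])
        show "kinetic_bound M (f eps n j)" for j using elim(3) by blast
        show "modified_ugks_step P eps (rho eps) (f eps) n j" for j
          using elim(4) unfolding modified_ugks_solution_def by blast
        show "implicit_diffusion_step P r n j" for j
          using r unfolding implicit_diffusion_solution_def by blast
        show "\<bar>rho eps n j - r n j\<bar> \<le> c * d / 2" for j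
          using elim(1) by (auto simp: dist_real_def intro: less_imp_le)
      qed
      also have "c * d / 2 + ?C * eps < c * d" using elim(2) by linarith
      finally have "c * \<bar>rho eps (n + 1) i - r (n + 1) i\<bar> < c * d" for i .
      then show ?case using c by (simp add: dist_real_def)
    qed
  qed
  have "\<forall>\<^sub>F eps in at_right 0. \<forall>i\<in>UNIV. dist (rho eps (n + 1) i) (r (n + 1) i) < 1"
    by (intro uniform_limitD[OF lim']) auto
  then have "\<forall>\<^sub>F eps in at_right 0. \<forall>i. kinetic_bound (next_bound M (R + 1)) (f eps (n + 1) i)"
    using M sol eventually_small
  proof eventually_elim
    case (elim eps)
    have rho: "\<bar>rho eps (n + 1) j\<bar> \<le> R + 1" for j
      using bspec[OF elim(1) UNIV_I, of j] R[of j] unfolding dist_real_def by linarith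
    have upd: "f eps (n + 1) i v = kinetic_update eps (rho eps) (f eps) n i v" if "v \<in> {-1..1}" for i v
      using elim(3) that
      unfolding modified_ugks_solution_def modified_ugks_step_def kinetic_relation_update[OF elim(4)]
      by blast
    show ?case
      using kinetic_bound_cong[OF kinetic_update_bound[where f="f eps" and M=M and n=n and rho="rho eps" and R="R + 1", OF elim(4) _ rho] upd] elim(2) by blast
  qed
  with lim' show ?case by auto
qed

end

section \<open>The diffusion limit\<close>

theorem mainTheorem5:
  fixes P :: ugks_data
  assumes "dx P > 0" and "dt P > 0"
    and "\<forall>i. sigma_cell P i > 0" and "\<forall>i. sigma_face P i > 0"
  shows
    "(\<forall>(rho :: real \<Rightarrow> nat \<Rightarrow> int \<Rightarrow> real) (f :: real \<Rightarrow> nat \<Rightarrow> int \<Rightarrow> real \<Rightarrow> real)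
        (r :: nat \<Rightarrow> int \<Rightarrow> real) (n :: nat) (i :: int).
        (\<forall>\<^sub>F eps in at_right 0. modified_ugks_step P eps (rho eps) (f eps) n i) \<longrightarrow>
        (\<exists>M. \<forall>\<^sub>F eps in at_right 0. \<forall>j\<in>{i - 1..i + 1}. kinetic_bound M (f eps n j)) \<longrightarrow>
        ((\<lambda>eps. rho eps n i) \<longlongrightarrow> r n i) (at_right 0) \<longrightarrow>
        (\<forall>j\<in>{i - 1..i + 1}. ((\<lambda>eps. rho eps (n + 1) j) \<longlongrightarrow> r (n + 1) j) (at_right 0)) \<longrightarrow>
        implicit_diffusion_step P r n i)
     \<and>
     (uniform_data P \<longrightarrow>
      (\<forall>(f0 :: real \<Rightarrow> int \<Rightarrow> real \<Rightarrow> real) (r0 :: int \<Rightarrow> real).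
        (\<exists>M. \<forall>\<^sub>F eps in at_right 0. \<forall>i. kinetic_bound M (f0 eps i)) \<longrightarrow>
        uniform_limit UNIV (\<lambda>eps i. mean (f0 eps i)) r0 (at_right 0) \<longrightarrow>
        (\<forall>\<^sub>F eps in at_right 0. \<exists>rho f. modified_ugks_solution P eps (f0 eps) rho f) \<and>
        (\<exists>!r. implicit_diffusion_solution P r0 r) \<and>
        (\<forall>rho f r.
           (\<forall>\<^sub>F eps in at_right 0.
              modified_ugks_solution P eps (f0 eps) (rho eps) (f eps)) \<longrightarrow>
           implicit_diffusion_solution P r0 r \<longrightarrow>
           (\<forall>n. uniform_limit UNIV (\<lambda>eps. rho eps n) (r n) (at_right 0)))))"
proof (intro conjI)
  show "\<forall>(rho :: real \<Rightarrow> nat \<Rightarrow> int \<Rightarrow> real) (f :: real \<Rightarrow> nat \<Rightarrow> int \<Rightarrow> real \<Rightarrow> real)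
        (r :: nat \<Rightarrow> int \<Rightarrow> real) (n :: nat) (i :: int).
        (\<forall>\<^sub>F eps in at_right 0. modified_ugks_step P eps (rho eps) (f eps) n i) \<longrightarrow>
        (\<exists>M. \<forall>\<^sub>F eps in at_right 0. \<forall>j\<in>{i - 1..i + 1}. kinetic_bound M (f eps n j)) \<longrightarrow>
        ((\<lambda>eps. rho eps n i) \<longlongrightarrow> r n i) (at_right 0) \<longrightarrow>
        (\<forall>j\<in>{i - 1..i + 1}. ((\<lambda>eps. rho eps (n + 1) j) \<longlongrightarrow> r (n + 1) j) (at_right 0)) \<longrightarrow>
        implicit_diffusion_step P r n i"
  proof (intro allI impI)
    fix rho :: "real \<Rightarrow> nat \<Rightarrow> int \<Rightarrow> real" and f :: "real \<Rightarrow> nat \<Rightarrow> int \<Rightarrow> real \<Rightarrow> real"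
      and r :: "nat \<Rightarrow> int \<Rightarrow> real" and n :: nat and i :: int
    assume step: "\<forall>\<^sub>F eps in at_right 0. modified_ugks_step P eps (rho eps) (f eps) n i"
      and "\<exists>M. \<forall>\<^sub>F eps in at_right 0. \<forall>j\<in>{i - 1..i + 1}. kinetic_bound M (f eps n j)"
      and lim: "((\<lambda>eps. rho eps n i) \<longlongrightarrow> r n i) (at_right 0)"
        "\<forall>j\<in>{i - 1..i + 1}. ((\<lambda>eps. rho eps (n + 1) j) \<longlongrightarrow> r (n + 1) j) (at_right 0)"
    then obtain M where "\<forall>\<^sub>F eps in at_right 0. \<forall>j\<in>{i - 1..i + 1}. kinetic_bound M (f eps n j)" by blast
    from modified_ugks_step_limit[OF assms(1,2) assms(4)[rule_format] step this lim(1) lim(2)[rule_format]]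
    show "implicit_diffusion_step P r n i" .
  qed
next
  show "uniform_data P \<longrightarrow>
      (\<forall>(f0 :: real \<Rightarrow> int \<Rightarrow> real \<Rightarrow> real) (r0 :: int \<Rightarrow> real).
        (\<exists>M. \<forall>\<^sub>F eps in at_right 0. \<forall>i. kinetic_bound M (f0 eps i)) \<longrightarrow>
        uniform_limit UNIV (\<lambda>eps i. mean (f0 eps i)) r0 (at_right 0) \<longrightarrow>
        (\<forall>\<^sub>F eps in at_right 0. \<exists>rho f. modified_ugks_solution P eps (f0 eps) rho f) \<and>
        (\<exists>!r. implicit_diffusion_solution P r0 r) \<and>
        (\<forall>rho f r.
           (\<forall>\<^sub>F eps in at_right 0.
              modified_ugks_solution P eps (f0 eps) (rho eps) (f eps)) \<longrightarrow>
           implicit_diffusion_solution P r0 r \<longrightarrow>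
           (\<forall>n. uniform_limit UNIV (\<lambda>eps. rho eps n) (r n) (at_right 0))))"
  proof (intro impI allI)
    fix f0 :: "real \<Rightarrow> int \<Rightarrow> real \<Rightarrow> real" and r0 :: "int \<Rightarrow> real"
    assume data: "uniform_data P"
      and "\<exists>M. \<forall>\<^sub>F eps in at_right 0. \<forall>i. kinetic_bound M (f0 eps i)"
      and init: "uniform_limit UNIV (\<lambda>eps i. mean (f0 eps i)) r0 (at_right 0)"
    then obtain M where M: "\<forall>\<^sub>F eps in at_right 0. \<forall>i. kinetic_bound M (f0 eps i)" by blast
    from data obtain s0 where s0: "0 < s0" "\<And>i. s0 \<le> sigma_cell P i" "\<And>i. s0 \<le> sigma_face P i"
      unfolding uniform_data_def by blast
    from data obtain c where c: "0 < c" "\<And>i. c \<le> reaction P i"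
      unfolding uniform_data_def by blast
    from data obtain K Gc Gf where K: "\<And>i. \<bar>alpha_face P i\<bar> \<le> K"
      and G: "\<And>i. \<bar>G_cell P i\<bar> \<le> Gc" "\<And>i. \<bar>G_face P i\<bar> \<le> Gf"
      unfolding uniform_data_def bounded_iff by auto
    interpret uniform_ugks P s0 K "max Gc Gf" c
      using assms s0 c K G by unfold_locales (auto simp: le_max_iff_disj)
    have "\<forall>\<^sub>F eps in at_right 0. \<exists>rho f. modified_ugks_solution P eps (f0 eps) rho f"
      using eventually_small M by eventually_elim (rule solution_exists, auto)
    moreover have "bounded (range r0)"
    proof -
      have "\<forall>\<^sub>F eps in at_right 0. \<forall>i\<in>UNIV. dist (mean (f0 eps i)) (r0 i) < 1"
        by (intro uniform_limitD[OF init]) auto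
      then have "\<forall>\<^sub>F eps in at_right (0::real). \<forall>i. \<bar>r0 i\<bar> \<le> M + 1"
        using M
      proof eventually_elim
        case (elim eps)
        show ?case
        proof
          fix i
          have "dist (mean (f0 eps i)) (r0 i) < 1" "\<bar>mean (f0 eps i)\<bar> \<le> M"
            using elim mean_bound by auto
          then show "\<bar>r0 i\<bar> \<le> M + 1" unfolding dist_real_def by linarith
        qed
      qed
      then have "\<forall>i. \<bar>r0 i\<bar> \<le> M + 1" by simp
      then show ?thesis by (auto simp: bounded_iff)
    qed
    then have "\<exists>!r. implicit_diffusion_solution P r0 r"
      using diffusion_solution_exists diffusion_solution_unique by blast
    moreover have "\<forall>rho f r.
           (\<forall>\<^sub>F eps in at_right 0.
              modified_ugks_solution P eps (f0 eps) (rho eps) (f eps)) \<longrightarrow>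
           implicit_diffusion_solution P r0 r \<longrightarrow>
           (\<forall>n. uniform_limit UNIV (\<lambda>eps. rho eps n) (r n) (at_right 0))"
      using convergence[OF M init] by blast
    ultimately show "(\<forall>\<^sub>F eps in at_right 0. \<exists>rho f. modified_ugks_solution P eps (f0 eps) rho f) \<and>
        (\<exists>!r. implicit_diffusion_solution P r0 r) \<and>
        (\<forall>rho f r.
           (\<forall>\<^sub>F eps in at_right 0.
              modified_ugks_solution P eps (f0 eps) (rho eps) (f eps)) \<longrightarrow>
           implicit_diffusion_solution P r0 r \<longrightarrow>
           (\<forall>n. uniform_limit UNIV (\<lambda>eps. rho eps n) (r n) (at_right 0)))"
      by blast
  qed
qed

end
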